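(* Let $q$ be a prime power and let $\mathcal{X}=Z(f_{\mathcal{X}})$ be a non-degenerate (parabolic) quadric in $\mathbb{P}^4(\mathbb{F}_q)$. For every quadric $\mathcal{Q}=Z(f)$ in $\mathbb{P}^4(\mathbb{F}_q)$, where $f$ is a nonzero form of degree 2 which is not a scalar multiple of $f_{\mathcal{X}}$, one has $$\#(\mathcal{X}\cap\mathcal{Q})(\mathbb{F}_q)\le 2q^2+3q+1,$$ and this bound is the best possible (it is attained by some such $\mathcal{Q}$). Moreover, the code $C_2(\mathcal{X})$ is an $[n,k,d]_q$-code (length $n$, dimension $k$, minimum distance $d$) with $$n=(q+1)(q^2+1),\qquad k=14,\qquad d=q^3-q^2-2q.$$
   Context: A quadric in $\mathbb{P}^4(\mathbb{F}_q)$ is the zero set $Z(f)$ of a nonzero form (homogeneous polynomial) $f$ of degree 2 in $x_0,\dots,x_4$ over $\mathbb{F}_q$. Its rank is the smallest number of indeterminates appearing in $f$ after an invertible linear change of coordinates; the quadric is non-degenerate if its rank is 5 (then it is called parabolic). Functional code: for a variety $X\subset\mathbb{P}^4(\mathbb{F}_q)$ let $\mathcal{F}_2$ be the $\mathbb{F}_q$-vector space of forms of degree 2 in $x_0,\dots,x_4$ (with $0$). The code $C_2(X)$ is the image of the linear map $c:\mathcal{F}_2\to\mathbb{F}_q^{|X|}$, $c(f)=(c_x(f))_{x\in X(\mathbb{F}_q)}$, where $c_x(f)=f(x_0,\dots,x_4)/x_i^2$ for $x=(x_0:\dots:x_4)$ and $i$ the smallest index with $x_i\neq0$. The length is $|X|=\#X(\mathbb{F}_q)$;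 the weight of $c(f)$ is $\#X(\mathbb{F}_q)-\#(X\cap Z(f))(\mathbb{F}_q)$; the minimum distance is the smallest weight of a nonzero codeword.
   Formalization: For q = 2 the bound being attained and d = q^3-q^2-2q are not claimed: there the bound 15 equals #X and d would be 0, impossible for a nonzero codeword as k = 14. The upper bound, n and k are stated for every q. *)

theory Defs
  imports "HOL-Analysis.Analysis" "HOL-Library.Poly_Mapping" "HOL-Library.Function_Algebras"
begin

(* Polynomials in indeterminates indexed by 'n: a monomial is its exponent function
   'n => nat, a polynomial maps monomials to coefficients. Addition and multiplication are
   those of Poly_Mapping. *)

type_synonym ('n, 'a) mpoly = "('n \<Rightarrow>\<^sub>0 nat) \<Rightarrow>\<^sub>0 'a"

definition const_poly :: "'a::zero \<Rightarrow> ('n, 'a) mpoly" where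
  "const_poly c = Poly_Mapping.single 0 c"

definition var_poly :: "'n \<Rightarrow> ('n, 'a::zero_neq_one) mpoly" where
  "var_poly i = Poly_Mapping.single (Poly_Mapping.single i 1) 1"

definition poly_eval :: "('n::finite, 'a::comm_ring_1) mpoly \<Rightarrow> 'a ^ 'n \<Rightarrow> 'a" where
  "poly_eval f v = (\<Sum>m\<in>Poly_Mapping.keys f.
     Poly_Mapping.lookup f m * (\<Prod>i\<in>UNIV. (v $ i) ^ Poly_Mapping.lookup m i))"

text \<open>Forms of degree 2; the zero polynomial is included.\<close>

definition forms2 :: "('n::finite, 'a::comm_ring_1) mpoly set" where
  "forms2 = {f. \<forall>m\<in>Poly_Mapping.keys f. (\<Sum>i\<in>UNIV. Poly_Mapping.lookup m i) = 2}"

definition indets :: "('n::finite, 'a::comm_ring_1) mpoly \<Rightarrow> 'n set" where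
  "indets f = (\<Union>m\<in>Poly_Mapping.keys f. Poly_Mapping.keys m)"

text \<open>The substitution that replaces the indeterminate with index \<open>i\<close> by the linear form
  whose coefficients are row \<open>i\<close> of \<open>A\<close>.\<close>

definition lin_subst ::
    "'a::comm_ring_1 ^ 'n::finite ^ 'n \<Rightarrow> ('n, 'a) mpoly \<Rightarrow> ('n, 'a) mpoly" where
  "lin_subst A f = (\<Sum>m\<in>Poly_Mapping.keys f.
     const_poly (Poly_Mapping.lookup f m) *
     (\<Prod>i\<in>UNIV. (\<Sum>j\<in>UNIV. const_poly (A $ i $ j) * var_poly j) ^ Poly_Mapping.lookup m i))"

definition quadric_rank :: "('n::finite, 'a::field) mpoly \<Rightarrow> nat" where
  "quadric_rank f = (LEAST r. \<exists>A :: 'a ^ 'n ^ 'n. invertible A \<and> card (indets (lin_subst A f)) = r)"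

text \<open>A projective point is the set of its homogeneous coordinate vectors, that is, a class of
  nonzero vectors modulo nonzero scalars.\<close>

definition proj_points :: "('a::field ^ 'n) set set" where
  "proj_points = (UNIV - {0}) // {(v, w). \<exists>c. c \<noteq> 0 \<and> w = c *s v}"

definition zero_set :: "('n::finite, 'a::field) mpoly \<Rightarrow> ('a ^ 'n) set set" where
  "zero_set f = {p \<in> proj_points. \<forall>v\<in>p. poly_eval f v = 0}"

text \<open>The value \<open>f(x) / x\<^sub>i\<^sup>2\<close> with \<open>i\<close> the smallest index such that \<open>x\<^sub>i \<noteq> 0\<close>. The order on the
  numeral type \<open>5\<close> is \<open>0 < 1 < 2 < 3 < 4\<close>.\<close>

definition normalized_eval ::
    "('n::{finite,linorder}, 'a::field) mpoly \<Rightarrow> 'a ^ 'n::{finite,linorder} \<Rightarrow> 'a" where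
  "normalized_eval f v = poly_eval f v / (v $ Min {i. v $ i \<noteq> 0}) ^ 2"

text \<open>Words indexed by a set \<open>X\<close> of points are functions on all sets of vectors that vanish
  outside \<open>X\<close>. The choice of the representative is immaterial, see
  \<open>normalized_eval_representative\<close> below.\<close>

definition codeword ::
    "('a::field ^ 'n::{finite,linorder}) set set \<Rightarrow> ('n, 'a) mpoly \<Rightarrow> ('a ^ 'n::{finite,linorder}) set \<Rightarrow> 'a" where
  "codeword X f = (\<lambda>p. if p \<in> X then normalized_eval f (SOME v. v \<in> p) else 0)"

definition functional_code2 ::
    "('a::field ^ 'n::{finite,linorder}) set set \<Rightarrow> (('a ^ 'n::{finite,linorder}) set \<Rightarrow> 'a) set" where
  "functional_code2 X = codeword X ` forms2"

definition word_scale :: "'a::field \<Rightarrow> ('p \<Rightarrow> 'a) \<Rightarrow> 'p \<Rightarrow> 'a" where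
  "word_scale c w = (\<lambda>p. c * w p)"

definition code_dim :: "('p \<Rightarrow> 'a::field) set \<Rightarrow> nat" where
  "code_dim C = vector_space.dim word_scale C"

definition weight :: "('p \<Rightarrow> 'a::field) \<Rightarrow> nat" where
  "weight w = card {p. w p \<noteq> 0}"

definition min_distance :: "('p \<Rightarrow> 'a::field) set \<Rightarrow> nat" where
  "min_distance C = Min (weight ` (C - {0}))"

lemma vector_space_word_scale: "vector_space word_scale"
  by unfold_locales (auto simp: word_scale_def fun_eq_iff algebra_simps)

lemma poly_eval_scale:
  fixes v :: "'a::field ^ 'n::finite"
  assumes "f \<in> forms2"
  shows "poly_eval f (c *s v) = c ^ 2 * poly_eval f v"
proof -
  have "Poly_Mapping.lookup f m * (\<Prod>i\<in>UNIV. ((c *s v) $ i) ^ Poly_Mapping.lookup m i) =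
        c ^ 2 * (Poly_Mapping.lookup f m * (\<Prod>i\<in>UNIV. (v $ i) ^ Poly_Mapping.lookup m i))"
    if "m \<in> Poly_Mapping.keys f" for m
  proof -
    have "(\<Prod>i\<in>UNIV. c ^ Poly_Mapping.lookup m i) = c ^ 2"
      using assms that by (simp add: forms2_def flip: power_sum)
    then show ?thesis
      by (simp add: power_mult_distrib prod.distrib)
  qed
  then show ?thesis
    unfolding poly_eval_def sum_distrib_left by (intro sum.cong) auto
qed

lemma normalized_eval_scale:
  assumes "f \<in> forms2" "c \<noteq> 0"
  shows "normalized_eval f (c *s v) = normalized_eval f v"
  using assms by (simp add: normalized_eval_def poly_eval_scale power_mult_distrib)

lemma proj_pointE:
  assumes "p \<in> proj_points"
  obtains u where "u \<noteq> 0" "p = {c *s u |c. c \<noteq> 0}"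
  using assms unfolding proj_points_def quotient_def by blast

lemma normalized_eval_representative:
  assumes "f \<in> forms2" "p \<in> proj_points" "v \<in> p"
  shows "normalized_eval f (SOME v. v \<in> p) = normalized_eval f v"
proof -
  obtain u where u: "p = {c *s u |c. c \<noteq> 0}"
    using assms(2) by (rule proj_pointE)
  have "normalized_eval f w = normalized_eval f u" if "w \<in> p" for w
    using that assms(1) by (auto simp: u normalized_eval_scale)
  then show ?thesis
    using assms(3) someI[of "\<lambda>v. v \<in> p" v] by simp
qed

lemma codeword_eq_0_iff:
  fixes X :: "('a::field ^ 'n::{finite,linorder}) set set"
  assumes f: "f \<in> forms2" and X: "X \<subseteq> proj_points" and p: "p \<in> X"
  shows "codeword X f p = 0 \<longleftrightarrow> p \<in> zero_set f"
proof -
  have pp: "p \<in> proj_points"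
    using X p by blast
  obtain u where u: "u \<noteq> 0" "p = {c *s u |c. c \<noteq> 0}"
    using pp by (rule proj_pointE)
  have "u = 1 *s u"
    by simp
  then have up: "u \<in> p"
    unfolding u(2) mem_Collect_eq by (intro exI[of _ 1] conjI zero_neq_one[symmetric])
  have "{i. u $ i \<noteq> 0} \<noteq> {}"
    using u(1) by (auto simp: vec_eq_iff)
  then have "u $ Min {i. u $ i \<noteq> 0} \<noteq> 0"
    using Min_in[of "{i. u $ i \<noteq> 0}"] by simp
  moreover have "codeword X f p = normalized_eval f u"
    using p normalized_eval_representative[OF f pp up] by (simp add: codeword_def)
  ultimately have "codeword X f p = 0 \<longleftrightarrow> poly_eval f u = 0"
    by (simp add: normalized_eval_def)
  also have "\<dots> \<longleftrightarrow> (\<forall>v\<in>p. poly_eval f v = 0)"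
  proof
    assume "poly_eval f u = 0"
    then show "\<forall>v\<in>p. poly_eval f v = 0"
      by (auto simp: u(2) poly_eval_scale[OF f])
  qed (use up in blast)
  also have "\<dots> \<longleftrightarrow> p \<in> zero_set f"
    using pp by (simp add: zero_set_def)
  finally show ?thesis .
qed

lemma weight_codeword:
  fixes X :: "('a::{field,finite} ^ 'n::{finite,linorder}) set set"
  assumes "f \<in> forms2" "X \<subseteq> proj_points"
  shows "weight (codeword X f) = card X - card (X \<inter> zero_set f)"
proof -
  have "{p. codeword X f p \<noteq> 0} = X - X \<inter> zero_set f"
  proof (rule set_eqI)
    fix p
    show "p \<in> {p. codeword X f p \<noteq> 0} \<longleftrightarrow> p \<in> X - X \<inter> zero_set f"
      by (cases "p \<in> X") (simp_all add: codeword_eq_0_iff[OF assms], simp add: codeword_def)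
  qed
  then show ?thesis
    by (simp add: weight_def card_Diff_subset)
qed

end

theory Submission
  imports Defs
begin

text \<open>Count zeros in the affine space \<open>V = F\<^sup>5\<close>, with subspaces measured by their cardinality.
  The engine is a reduction step: if \<open>v\<close> is a zero of \<open>Q\<close> in a subspace \<open>S\<close> of size \<open>q\<^sup>n\<^sup>+\<^sup>2\<close> that is not
  orthogonal to \<open>S\<close>, then \<open>S\<close> contains \<open>q\<^sup>n\<^sup>+\<^sup>1 - q\<^sup>n\<close> more zeros than the hyperplane of \<open>S\<close> orthogonal to
  \<open>v\<close>. It shows that a quadratic map on \<open>V\<close> is a product of two linear forms or has at most
  \<open>q\<^sup>4 + q\<^sup>3 - q\<^sup>2\<close> zeros. If no member \<open>f + c Q\<close> of the pencil is a product, summing the numbers of zeros of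
  its members gives at most \<open>2q\<^sup>3 - q\<^sup>2\<close> common zeros. Otherwise the common zeros lie in two hyperplanes
  \<open>H\<close> and \<open>K\<close>, each with at most \<open>q\<^sup>3 + q\<^sup>2 - q\<close> zeros of \<open>Q\<close>; if \<open>H \<inter> K\<close> has fewer than \<open>q\<^sup>2\<close> zeros, then \<open>H\<close>
  and \<open>K\<close> have at most \<open>q\<^sup>3\<close> each. In both cases there are at most \<open>2q\<^sup>3 + q\<^sup>2 - 2q\<close> common zeros, which is
  \<open>2q\<^sup>2 + 3q + 1\<close> projective points. Equality needs two suitable points on a conic besides those on a
  fixed secant, which exist exactly for \<open>q \<noteq> 2\<close>. The dimension of the code is found by counting its words:
  a form vanishing on the quadric is a multiple of its equation.\<close>

section \<open>Counting in subspaces\<close>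

definition functional :: "('a::field ^ 'n \<Rightarrow> 'a) \<Rightarrow> bool" where
  "functional l \<longleftrightarrow> (\<forall>x y. l (x + y) = l x + l y) \<and> (\<forall>c x. l (c *s x) = c * l x)"

lemma functionalD:
  assumes "functional l"
  shows "l (x + y) = l x + l y" "l (c *s x) = c * l x" "l 0 = 0" "l (- x) = - l x"
    "l (x - y) = l x - l y"
proof -
  show add: "l (x + y) = l x + l y" for x y
    using assms by (simp add: functional_def)
  show scale: "l (c *s x) = c * l x" for c x
    using assms by (simp add: functional_def)
  show "l 0 = 0"
    using scale[of 0 0] by simp
  show neg: "l (- x) = - l x" for x
    using scale[of "-1" x] by simp
  show "l (x - y) = l x - l y"
    using add[of x "- y"] by (simp add: neg)
qed

lemma functional_add: "functional l \<Longrightarrow> functional m \<Longrightarrow> functional (\<lambda>x. l x + m x)"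
  by (simp add: functional_def algebra_simps)

lemma functional_scale: "functional l \<Longrightarrow> functional (\<lambda>x. c * l x)"
  by (simp add: functional_def algebra_simps)

lemma functional_diff: "functional l \<Longrightarrow> functional m \<Longrightarrow> functional (\<lambda>x. l x - m x)"
  by (simp add: functional_def algebra_simps)

lemma subspace_kernel:
  assumes "functional l" "vec.subspace S"
  shows "vec.subspace {x \<in> S. l x = 0}"
  using assms by (auto simp: vec.subspace_def functionalD)

lemma two_le_card_field: "2 \<le> CARD('a::{field,finite})"
proof -
  have "card {0, 1 :: 'a} \<le> CARD('a)"
    by (intro card_mono) auto
  then show ?thesis by simp
qed

definition adjoin :: "('a::field ^ 'n) set \<Rightarrow> 'a ^ 'n \<Rightarrow> ('a ^ 'n) set" where
  "adjoin S w = {x + c *s w | x c. x \<in> S}"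

lemma subspace_adjoin:
  assumes S: "vec.subspace S"
  shows "vec.subspace (adjoin S w)"
proof (rule vec.subspaceI)
  show "0 \<in> adjoin S w"
    using vec.subspace_0[OF S] unfolding adjoin_def by (force intro!: exI[of _ 0])
next
  fix x y
  assume "x \<in> adjoin S w" "y \<in> adjoin S w"
  then obtain a c b d where "x = a + c *s w" "a \<in> S" "y = b + d *s w" "b \<in> S"
    by (auto simp: adjoin_def)
  then have "x + y = (a + b) + (c + d) *s w" "a + b \<in> S"
    using vec.subspace_add[OF S] by (auto simp: vec.scale_left_distrib)
  then show "x + y \<in> adjoin S w"
    unfolding adjoin_def by blast
next
  fix k x
  assume "x \<in> adjoin S w"
  then obtain a c where "x = a + c *s w" "a \<in> S"
    by (auto simp: adjoin_def)
  then have "k *s x = k *s a + (k * c) *s w" "k *s a \<in> S"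
    using vec.subspace_scale[OF S] by (auto simp: vec.scale_right_distrib)
  then show "k *s x \<in> adjoin S w"
    unfolding adjoin_def by blast
qed

text \<open>If \<open>x + c *s w = y + d *s w\<close> with \<open>c \<noteq> d\<close>, then
  \<open>w\<close> is a multiple of \<open>y - x\<close> and lies in \<open>S\<close>. So
  representations are unique. Adjoining single vectors in this way takes the place of bases and
  dimensions.\<close>

lemma card_adjoin:
  fixes S :: "('a::{field,finite} ^ 'n::finite) set"
  assumes S: "vec.subspace S" and w: "w \<notin> S"
  shows "card (adjoin S w) = CARD('a) * card S"
proof -
  have "inj_on (\<lambda>(x, c). x + c *s w) (S \<times> UNIV)"
  proof (rule inj_onI, clarify)
    fix x c y d
    assume xy: "x \<in> S" "y \<in> S" and eq: "x + c *s w = y + d *s w"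
    then have "(c - d) *s w = y - x"
      by (simp add: vec.scale_left_diff_distrib algebra_simps)
    then have *: "(c - d) *s w \<in> S"
      using vec.subspace_diff[OF S] xy by simp
    have "c = d"
    proof (rule ccontr)
      assume "c \<noteq> d"
      then have "inverse (c - d) *s ((c - d) *s w) = w"
        by (simp only: vec.scale_scale) simp
      then show False
        using vec.subspace_scale[OF S *, of "inverse (c - d)"] w by simp
    qed
    then show "x = y \<and> c = d"
      using eq by simp
  qed
  then have "card ((\<lambda>(x, c). x + c *s w) ` (S \<times> UNIV)) = card S * CARD('a)"
    by (simp add: card_image card_cartesian_product)
  moreover have "(\<lambda>(x, c). x + c *s w) ` (S \<times> UNIV) = adjoin S w"
    by (auto simp: adjoin_def)
  ultimately show ?thesis by simp
qed

lemma adjoin_subset: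
  assumes "vec.subspace T" "S \<subseteq> T" "w \<in> T"
  shows "adjoin S w \<subseteq> T"
  using assms by (auto simp: adjoin_def intro!: vec.subspace_add vec.subspace_scale)

lemma card_psubspace_le:
  fixes S :: "('a::{field,finite} ^ 'n::finite) set"
  assumes "vec.subspace S" "vec.subspace T" "S \<subseteq> T" "w \<in> T" "w \<notin> S"
  shows "CARD('a) * card S \<le> card T"
proof -
  have "card (adjoin S w) \<le> card T"
    using adjoin_subset[OF assms(2-4)] by (intro card_mono) auto
  then show ?thesis
    using card_adjoin[OF assms(1,5)] by simp
qed

text \<open>Subtracting \<open>(l x / l w) *s w\<close> projects \<open>x\<close> into the kernel
  along \<open>w\<close>, so \<open>S\<close> is the kernel with \<open>w\<close> adjoined.\<close>

lemma card_kernel: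
  fixes S :: "('a::{field,finite} ^ 'n::finite) set"
  assumes l: "functional l" and S: "vec.subspace S" and w: "w \<in> S" "l w \<noteq> 0"
  shows "CARD('a) * card {x \<in> S. l x = 0} = card S"
proof -
  let ?K = "{x \<in> S. l x = 0}"
  have "S \<subseteq> adjoin ?K w"
  proof
    fix x assume "x \<in> S"
    then have "x - (l x / l w) *s w \<in> ?K"
      using w vec.subspace_diff[OF S] vec.subspace_scale[OF S] l by (simp add: functionalD)
    moreover have "x = (x - (l x / l w) *s w) + (l x / l w) *s w"
      by simp
    ultimately show "x \<in> adjoin ?K w"
      unfolding adjoin_def by blast
  qed
  moreover have "adjoin ?K w \<subseteq> S"
    using w by (intro adjoin_subset S) auto
  ultimately show ?thesis
    using card_adjoin[OF subspace_kernel[OF l S], of w] w by simp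
qed

text \<open>This covers functionals that vanish on \<open>S\<close> as well, so hyperplane cuts can
  be iterated without deciding at each step whether they are proper.\<close>

lemma card_kernel_ge:
  fixes S :: "('a::{field,finite} ^ 'n::finite) set"
  assumes "functional l" "vec.subspace S"
  shows "card S \<le> CARD('a) * card {x \<in> S. l x = 0}"
proof (cases "\<exists>w\<in>S. l w \<noteq> 0")
  case True
  then show ?thesis
    using card_kernel[OF assms] by auto
next
  case False
  then have "{x \<in> S. l x = 0} = S"
    by auto
  then show ?thesis by simp
qed

lemma card_multiples:
  fixes r :: "'a::{field,finite} ^ 'n::finite"
  assumes "r \<noteq> 0"
  shows "card (range (\<lambda>c. c *s r)) = CARD('a)"
  using assms by (intro card_image) (auto simp: inj_on_def)

lemma ex_not_multiple:
  fixes S :: "('a::{field,finite} ^ 'n::finite) set"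
  assumes "CARD('a) < card S"
  shows "\<exists>w\<in>S. \<forall>c. w \<noteq> c *s r"
proof (rule ccontr)
  assume "\<not> ?thesis"
  then have "S \<subseteq> range (\<lambda>c. c *s r)"
    by auto
  then have "card S \<le> card (range (\<lambda>c. c *s r))"
    by (intro card_mono) auto
  also have "\<dots> \<le> CARD('a)"
    by (rule card_image_le) simp
  finally show False
    using assms by simp
qed

lemma ex_nonzero:
  fixes S :: "('a::zero ^ 'n::finite) set"
  assumes "1 < card S"
  shows "\<exists>w\<in>S. w \<noteq> 0"
proof (rule ccontr)
  assume "\<not> ?thesis"
  then have "S \<subseteq> {0}"
    by auto
  then show False
    using assms card_mono[of "{0}" S] by simp
qed

section \<open>Zeros of quadratic maps\<close>

text \<open>The polarization without division by 2, so that characteristic 2 is included; there it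
  is alternating on quadratic maps and does not determine \<open>Q\<close>.\<close>

definition polar :: "('v::ab_group_add \<Rightarrow> 'a::ab_group_add) \<Rightarrow> 'v \<Rightarrow> 'v \<Rightarrow> 'a" where
  "polar Q u v = Q (u + v) - Q u - Q v"

definition zeros :: "('v \<Rightarrow> 'a::zero) \<Rightarrow> 'v set \<Rightarrow> 'v set" where
  "zeros Q S = {x \<in> S. Q x = 0}"

definition perp :: "('v::ab_group_add \<Rightarrow> 'a::ab_group_add) \<Rightarrow> 'v \<Rightarrow> 'v set \<Rightarrow> 'v set" where
  "perp Q v S = {x \<in> S. polar Q v x = 0}"

text \<open>Linearity is demanded in the second argument of the polar form only; symmetry supplies
  the first.\<close>

locale quadratic =
  fixes Q :: "'a::field ^ 'n::finite \<Rightarrow> 'a"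
  assumes Q_scale: "Q (c *s v) = c^2 * Q v"
    and functional_polar: "functional (polar Q v)"

lemma (in quadratic) polar_commute: "polar Q u v = polar Q v u"
  by (simp add: polar_def add.commute)

lemma (in quadratic) Q_add: "Q (u + v) = Q u + Q v + polar Q u v"
  by (simp add: polar_def)

lemma (in quadratic) Q_0: "Q 0 = 0"
  using Q_scale[of 0 0] by simp

lemma (in quadratic) polar_linear:
  "polar Q w (u + v) = polar Q w u + polar Q w v" "polar Q w (c *s u) = c * polar Q w u"
  "polar Q w 0 = 0" "polar Q w (u - v) = polar Q w u - polar Q w v"
  "polar Q (u + v) w = polar Q u w + polar Q v w" "polar Q (c *s u) w = c * polar Q u w"
  "polar Q 0 w = 0" "polar Q (u - v) w = polar Q u w - polar Q v w"
  by (simp_all add: polar_commute[of _ w] functionalD[OF functional_polar])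

lemma (in quadratic) polar_self: "polar Q v v = 2 * Q v"
proof -
  have "v + v = 2 *s v"
    by (simp add: vec_eq_iff)
  then show ?thesis
    unfolding polar_def by (simp add: Q_scale)
qed

lemma (in quadratic) Q_diff_multiple: "Q (u - c *s v) = Q u + c^2 * Q v - c * polar Q u v"
proof -
  have "u - c *s v = u + (- c) *s v"
    by simp
  then show ?thesis
    using Q_add[of u "(- c) *s v"] by (simp only: Q_scale polar_linear) simp
qed

lemma (in quadratic) subspace_perp: "vec.subspace S \<Longrightarrow> vec.subspace (perp Q v S)"
  unfolding perp_def by (rule subspace_kernel[OF functional_polar])

lemma quadratic_pencil:
  assumes "quadratic f" "quadratic g"
  shows "quadratic (\<lambda>v. f v + c * g v)"
proof -
  interpret f: quadratic f by fact
  interpret g: quadratic g by fact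
  have "polar (\<lambda>v. f v + c * g v) u = (\<lambda>v. polar f u v + c * polar g u v)" for u
    by (simp add: polar_def algebra_simps fun_eq_iff)
  then show ?thesis
    by unfold_locales
      (simp_all add: f.Q_scale g.Q_scale algebra_simps functional_add functional_scale
        f.functional_polar g.functional_polar)
qed

lemma quadratic_product:
  fixes l m :: "'a::field ^ 'n::finite \<Rightarrow> 'a"
  assumes l: "functional l" and m: "functional m"
  shows "quadratic (\<lambda>v. l v * m v)"
proof -
  have "polar (\<lambda>v. l v * m v) u = (\<lambda>v. l u * m v + m u * l v)" for u
    using l m by (simp add: polar_def algebra_simps fun_eq_iff functionalD)
  then have "functional (polar (\<lambda>v. l v * m v) u)" for u
    using l m by (simp only: functional_add functional_scale)
  then show ?thesis
    by unfold_locales (use l m in \<open>simp_all add: functionalD power2_eq_square\<close>)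
qed

section \<open>Squares in finite fields\<close>

lemma squares_fiber_le: "card {x :: 'a::{field,finite}. x^2 = y} \<le> 2"
proof (cases "{x :: 'a. x^2 = y} = {}")
  case False
  then obtain z where "z^2 = y"
    by auto
  then have "{x. x^2 = y} \<subseteq> {z, - z}"
    by (auto simp: power2_eq_iff)
  then have "card {x. x^2 = y} \<le> card {z, - z}"
    by (intro card_mono) auto
  also have "\<dots> \<le> 2"
    by (rule card_insert_le_m1) auto
  finally show ?thesis .
qed (metis card.empty zero_le)

text \<open>Squaring has one preimage over 0 and at most two over any other square, so q is at most
  1 + 2(r - 1) for r squares.\<close>

lemma card_squares: "CARD('a::{field,finite}) + 1 \<le> 2 * card (range (\<lambda>x :: 'a. x^2))"
proof -
  let ?R = "range (\<lambda>x :: 'a. x^2)"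
  have 0: "0 \<in> ?R"
    by (metis rangeI zero_power2)
  have "{x :: 'a. x^2 = 0} = {0}"
    by auto
  then have z: "card {x :: 'a. x^2 = 0} = 1"
    by simp
  have "CARD('a) = (\<Sum>y\<in>?R. card {x. x \<in> UNIV \<and> x^2 = y})"
    using sum.image_gen[of "UNIV :: 'a set" "\<lambda>_. 1 :: nat" "\<lambda>x. x^2"] by simp
  also have "\<dots> = 1 + (\<Sum>y\<in>?R - {0}. card {x. x^2 = y})"
    using 0 z by (subst sum.remove[of _ 0]) auto
  also have "\<dots> \<le> 1 + (\<Sum>y\<in>?R - {0}. 2)"
    by (intro add_left_mono sum_mono squares_fiber_le)
  also have "\<dots> = 1 + 2 * (card ?R - 1)"
    using 0 by (simp add: card_Diff_singleton)
  finally have "CARD('a) \<le> 1 + 2 * (card ?R - 1)" .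
  moreover have "card ?R \<ge> 1"
    using 0 by (metis One_nat_def Suc_leI card_gt_0_iff empty_iff finite)
  ultimately show ?thesis by simp
qed

text \<open>Pigeonhole: the values of \<open>a * x^2\<close> and those of \<open>c - b * y^2\<close>
  each fill more than half of the field, so the two sets meet.\<close>

lemma binary_form_universal:
  fixes a b c :: "'a::{field,finite}"
  assumes "a \<noteq> 0" "b \<noteq> 0"
  shows "\<exists>x y. a * x^2 + b * y^2 = c"
proof (rule ccontr)
  assume no: "\<not> ?thesis"
  let ?R = "range (\<lambda>x :: 'a. x^2)"
  let ?A = "(*) a ` ?R" and ?B = "(\<lambda>t. c - b * t) ` ?R"
  have "?A \<inter> ?B = {}"
  proof (rule equals0I)
    fix z assume "z \<in> ?A \<inter> ?B"
    then obtain x y where "a * x^2 = c - b * y^2"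
      by auto
    then have "a * x^2 + b * y^2 = c"
      by simp
    then show False
      using no by blast
  qed
  then have "card (?A \<union> ?B) = card ?A + card ?B"
    by (intro card_Un_disjoint) auto
  also have "card ?A = card ?R"
    using assms by (intro card_image) (auto simp: inj_on_def)
  also have "card ?B = card ?R"
    using assms by (intro card_image) (auto simp: inj_on_def)
  finally have "2 * card ?R = card (?A \<union> ?B)"
    by simp
  also have "\<dots> \<le> CARD('a)"
    by (intro card_mono) auto
  finally show False
    using card_squares[where 'a = 'a] by simp
qed

text \<open>In characteristic 2 squaring is additive, hence injective, hence surjective on a finite
  field.\<close>

lemma square_root_char_2:
  fixes y :: "'a::{field,finite}"
  assumes "(2::'a) = 0"
  shows "\<exists>x. x^2 = y"
proof -
  have "x = z" if "x^2 = z^2" for x z :: 'a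
  proof -
    have "(x - z)^2 = x^2 + z^2 - 2 * x * z"
      by (simp add: power2_eq_square algebra_simps)
    also have "\<dots> = 2 * z^2"
      using that assms by simp
    finally show ?thesis
      using assms by simp
  qed
  then have "inj (\<lambda>x :: 'a. x^2)"
    by (auto intro: injI)
  then have "surj (\<lambda>x :: 'a. x^2)"
    by (intro finite_UNIV_inj_surj) auto
  then show ?thesis
    by (metis surjD)
qed

section \<open>Zeros of a quadratic map on a subspace\<close>

locale finite_quadratic = quadratic Q for Q :: "'a::{field,finite} ^ 'n::finite \<Rightarrow> 'a"

lemma (in finite_quadratic) card_perp:
  assumes "vec.subspace S" "w \<in> S" "polar Q v w \<noteq> 0"
  shows "CARD('a) * card (perp Q v S) = card S"
  unfolding perp_def by (rule card_kernel[OF functional_polar assms])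

lemma (in finite_quadratic) card_perp_ge:
  assumes "vec.subspace S"
  shows "card S \<le> CARD('a) * card (perp Q v S)"
  unfolding perp_def by (rule card_kernel_ge[OF functional_polar assms])

text \<open>Every coset \<open>x + F v\<close> with \<open>x\<close> outside the hyperplane orthogonal to the singular vector
  \<open>v\<close> contains exactly one zero.\<close>

lemma (in finite_quadratic) card_zeros_outside_perp:
  assumes S: "vec.subspace S" and v: "v \<in> S" "Q v = 0"
  shows "CARD('a) * card (zeros Q S - perp Q v S) = card (S - perp Q v S)"
proof -
  let ?O = "S - perp Q v S" and ?h = "\<lambda>(x, c). x + c *s v"
  have O: "x + c *s v \<in> ?O" if "x \<in> ?O" for x c
    using that v vec.subspace_add[OF S] vec.subspace_scale[OF S]
    by (auto simp: perp_def polar_linear polar_self)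
  have "bij_betw ?h ((zeros Q S - perp Q v S) \<times> UNIV) ?O"
  proof (rule bij_betw_imageI)
    show "inj_on ?h ((zeros Q S - perp Q v S) \<times> UNIV)"
    proof (rule inj_onI, clarify)
      fix x c y d
      assume x: "x \<in> zeros Q S" "x \<notin> perp Q v S" and y: "y \<in> zeros Q S" "y \<notin> perp Q v S"
        and eq: "x + c *s v = y + d *s v"
      have y': "y = x - (d - c) *s v"
        using eq by (simp add: vec.scale_left_diff_distrib algebra_simps)
      have "Q y = - (d - c) * polar Q x v"
        using x v unfolding y' Q_diff_multiple by (simp add: zeros_def algebra_simps)
      moreover have "polar Q x v \<noteq> 0"
        using x by (simp add: perp_def zeros_def polar_commute[of x])
      ultimately have "d = c"
        using y by (simp add: zeros_def)
      then show "x = y \<and> c = d"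
        using y' by simp
    qed
    show "?h ` ((zeros Q S - perp Q v S) \<times> UNIV) = ?O"
    proof
      show "?h ` ((zeros Q S - perp Q v S) \<times> UNIV) \<subseteq> ?O"
        using O by (auto simp: zeros_def)
      show "?O \<subseteq> ?h ` ((zeros Q S - perp Q v S) \<times> UNIV)"
      proof
        fix x assume x: "x \<in> ?O"
        then have p: "polar Q x v \<noteq> 0"
          by (auto simp: perp_def polar_commute[of x])
        \<comment> \<open>Along the coset, \<open>Q (x - c *s v) = Q x - c * polar Q x v\<close> is
          affine in \<open>c\<close>, because \<open>Q v = 0\<close>; this is its root.\<close>
        let ?c = "Q x / polar Q x v"
        have "Q (x - ?c *s v) = 0"
          unfolding Q_diff_multiple using v p by simp
        moreover have "x - ?c *s v \<in> ?O"
          using O[OF x, of "- ?c"] by simp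
        ultimately have "(x - ?c *s v, ?c) \<in> (zeros Q S - perp Q v S) \<times> UNIV"
          by (simp add: zeros_def)
        moreover have "x = ?h (x - ?c *s v, ?c)"
          by simp
        ultimately show "x \<in> ?h ` ((zeros Q S - perp Q v S) \<times> UNIV)"
          by (rule rev_image_eqI)
      qed
    qed
  qed
  from bij_betw_same_card[OF this] show ?thesis
    by (simp add: card_cartesian_product mult.commute)
qed

text \<open>Outside the hyperplane, one vector in q is a zero, which gives (q^(n+2) - q^(n+1)) / q
  zeros there. Writing q^n on the left avoids subtraction of naturals.\<close>

lemma (in finite_quadratic) card_zeros_reduction:
  assumes S: "vec.subspace S" "card S = CARD('a) ^ (n + 2)"
    and v: "v \<in> S" "Q v = 0" and w: "w \<in> S" "polar Q v w \<noteq> 0"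
  shows "card (perp Q v S) = CARD('a) ^ (n + 1)"
    and "card (zeros Q S) + CARD('a) ^ n = CARD('a) ^ (n + 1) + card (zeros Q (perp Q v S))"
proof -
  let ?q = "CARD('a)"
  show p: "card (perp Q v S) = ?q ^ (n + 1)"
    using card_perp[OF S(1) w] S(2) by simp
  have "card (zeros Q S) = card (zeros Q S - perp Q v S) + card (zeros Q (perp Q v S))"
  proof -
    have "zeros Q S = (zeros Q S - perp Q v S) \<union> zeros Q (perp Q v S)"
      by (auto simp: zeros_def perp_def)
    moreover have "(zeros Q S - perp Q v S) \<inter> zeros Q (perp Q v S) = {}"
      by (auto simp: zeros_def)
    ultimately show ?thesis
      by (metis card_Un_disjoint finite)
  qed
  moreover have "card (S - perp Q v S) + card (perp Q v S) = card S"
  proof -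
    have "perp Q v S \<subseteq> S"
      by (auto simp: perp_def)
    then show ?thesis
      by (simp add: card_Diff_subset card_mono)
  qed
  ultimately have "?q * (card (zeros Q S) + ?q ^ n) = ?q * (?q ^ (n + 1) + card (zeros Q (perp Q v S)))"
    using card_zeros_outside_perp[OF S(1) v] p S(2) by (simp add: distrib_left)
  then show "card (zeros Q S) + ?q ^ n = ?q ^ (n + 1) + card (zeros Q (perp Q v S))"
    by simp
qed

lemma (in quadratic) subspace_zeros:
  assumes S: "vec.subspace S" and sing: "\<And>v w. v \<in> zeros Q S \<Longrightarrow> w \<in> S \<Longrightarrow> polar Q v w = 0"
  shows "vec.subspace (zeros Q S)"
proof (rule vec.subspaceI)
  fix x y assume "x \<in> zeros Q S" "y \<in> zeros Q S"
  then show "x + y \<in> zeros Q S"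
    using sing[of x y] vec.subspace_add[OF S] by (simp add: zeros_def Q_add)
qed (use vec.subspace_0[OF S] vec.subspace_scale[OF S] in \<open>auto simp: zeros_def Q_0 Q_scale\<close>)

text \<open>If some zero is not orthogonal to \<open>S\<close>, the reduction applies and the
  remaining zeros are bounded by the whole hyperplane. Otherwise sums of zeros are zeros, so they
  form a proper subspace, of size at most q^(n+1).\<close>

lemma (in finite_quadratic) card_zeros_le:
  assumes S: "vec.subspace S" "card S = CARD('a) ^ (n + 2)" and x: "x \<in> S" "Q x \<noteq> 0"
  shows "card (zeros Q S) + CARD('a) ^ n \<le> 2 * CARD('a) ^ (n + 1)"
proof (cases "\<exists>v\<in>zeros Q S. \<exists>w\<in>S. polar Q v w \<noteq> 0")
  case True
  then obtain v w where v: "v \<in> S" "Q v = 0" and w: "w \<in> S" "polar Q v w \<noteq> 0"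
    by (auto simp: zeros_def)
  have "card (zeros Q (perp Q v S)) \<le> card (perp Q v S)"
    by (intro card_mono) (auto simp: zeros_def)
  then show ?thesis
    using card_zeros_reduction[OF S v w] by simp
next
  case False
  then have "vec.subspace (zeros Q S)"
    by (intro subspace_zeros S) auto
  then have "CARD('a) * card (zeros Q S) \<le> card S"
    by (rule card_psubspace_le[OF _ S(1) _ x(1)]) (use x in \<open>auto simp: zeros_def\<close>)
  then have "CARD('a) * card (zeros Q S) \<le> CARD('a) * CARD('a) ^ (n + 1)"
    using S(2) by simp
  then have "card (zeros Q S) \<le> CARD('a) ^ (n + 1)"
    by simp
  moreover have "CARD('a) ^ n \<le> CARD('a) ^ (n + 1)"
    by (intro power_increasing) auto
  ultimately show ?thesis by linarith
qed

text \<open>Three dimensions suffice for an isotropic vector. In characteristic 2, two independent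
  orthogonal vectors are enough, since every scalar is a square. In odd characteristic three
  mutually orthogonal vectors give a diagonal form, and a binary diagonal form takes the value
  \<open>- Q v3\<close>.\<close>

lemma (in finite_quadratic) ex_nontrivial_zero:
  assumes S: "vec.subspace S" "CARD('a) ^ 3 \<le> card S"
  shows "\<exists>v\<in>S. v \<noteq> 0 \<and> Q v = 0"
proof -
  let ?q = "CARD('a)"
  have q: "2 \<le> ?q" by (rule two_le_card_field)
  have p2: "?q ^ 2 \<le> card (perp Q v S)" for v
  proof -
    have "?q * ?q ^ 2 = ?q ^ 3"
      by (simp add: power3_eq_cube power2_eq_square)
    then have "?q * ?q ^ 2 \<le> ?q * card (perp Q v S)"
      using card_perp_ge[OF S(1), of v] S(2) by linarith
    then show ?thesis
      unfolding mult_le_cancel1 by simp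
  qed
  have p1: "?q \<le> card (perp Q u (perp Q v S))" for u v
  proof -
    have "?q * ?q \<le> ?q * card (perp Q u (perp Q v S))"
      using p2[of v, unfolded power2_eq_square] card_perp_ge[OF subspace_perp[OF S(1)], of v u]
      by (rule le_trans)
    then show ?thesis by simp
  qed
  have "1 < ?q ^ 3"
    using q by (intro one_less_power) auto
  then obtain v1 where v1: "v1 \<in> S" "v1 \<noteq> 0"
    using ex_nonzero[of S] S(2) by auto
  show ?thesis
  proof (cases "Q v1 = 0")
    case nz1: False
    show ?thesis
    proof (cases "(2::'a) = 0")
      case True
      have "?q < ?q ^ 2"
        using q by (simp add: power2_eq_square)
      then obtain w where w: "w \<in> perp Q v1 S" "\<And>c. w \<noteq> c *s v1"
        using ex_not_multiple[of "perp Q v1 S" v1] p2[of v1] by force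
      obtain t where t: "t^2 = - Q w / Q v1"
        using square_root_char_2[OF True] by blast
      have "Q (w - t *s v1) = 0"
        using w t nz1 unfolding Q_diff_multiple by (simp add: perp_def polar_commute)
      moreover have "w - t *s v1 \<noteq> 0" "w - t *s v1 \<in> S"
        using w v1 vec.subspace_diff[OF S(1)] vec.subspace_scale[OF S(1)]
        by (auto simp: perp_def)
      ultimately show ?thesis by blast
    next
      case False
      have "1 < card (perp Q v1 S)"
        using p2[of v1] q less_le_trans[OF one_less_power[of ?q 2]] by auto
      then obtain v2 where v2: "v2 \<in> perp Q v1 S" "v2 \<noteq> 0"
        using ex_nonzero by blast
      have "1 < card (perp Q v2 (perp Q v1 S))"
        using p1[of v2 v1] q by simp
      then obtain v3 where v3: "v3 \<in> perp Q v2 (perp Q v1 S)" "v3 \<noteq> 0"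
        using ex_nonzero by blast
      show ?thesis
      proof (cases "Q v2 = 0 \<or> Q v3 = 0")
        case True
        then show ?thesis
          using v2 v3 by (auto simp: perp_def)
      next
        case nz: False
        obtain x y where xy: "Q v1 * x^2 + Q v2 * y^2 = - Q v3"
          using binary_form_universal[OF nz1, of "Q v2"] nz by blast
        let ?v = "x *s v1 + y *s v2 + v3"
        have orth: "polar Q v1 v2 = 0" "polar Q v1 v3 = 0" "polar Q v2 v3 = 0"
          using v2 v3 by (auto simp: perp_def)
        have "Q ?v = 0"
          using xy orth by (simp add: Q_add Q_scale polar_linear mult.commute)
        moreover have "?v \<in> S"
          using v1 v2 v3 by (intro vec.subspace_add vec.subspace_scale S) (auto simp: perp_def)
        \<comment> \<open>Pairing \<open>?v\<close> with \<open>v3\<close> gives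
          \<open>2 * Q v3\<close>, which is nonzero in odd characteristic; this replaces linear
          independence.\<close>
        moreover have "?v \<noteq> 0"
        proof
          assume "?v = 0"
          then have "polar Q ?v v3 = 0"
            by (simp only: polar_linear)
          then show False
            using orth nz False by (simp add: polar_linear polar_self)
        qed
        ultimately show ?thesis by blast
      qed
    qed
  qed (use v1 in auto)
qed

text \<open>Take a zero \<open>v\<close> outside the radical of the polar form. If \<open>Q\<close>
  vanishes on its orthogonal hyperplane, then \<open>polar Q v\<close> divides \<open>Q\<close>; if
  not, \<open>card_zeros_le\<close> bounds the zeros in that hyperplane. Without such a
  \<open>v\<close> the zeros form a subspace, which is proper unless \<open>Q\<close> is the product
  of two zero functionals.\<close>

lemma (in finite_quadratic) product_or_card_zeros_le:
  assumes V: "CARD('a ^ 'n) = CARD('a) ^ (n + 3)"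
  shows "(\<exists>l m. functional l \<and> functional m \<and> (\<forall>x. Q x = l x * m x)) \<or>
    card (zeros Q UNIV) + CARD('a) ^ n \<le> CARD('a) ^ (n + 2) + CARD('a) ^ (n + 1)"
proof (cases "\<exists>v\<in>zeros Q UNIV. \<exists>w. polar Q v w \<noteq> 0")
  case True
  then obtain v w0 where v: "Q v = 0" and w0: "polar Q v w0 \<noteq> 0"
    by (auto simp: zeros_def)
  let ?K = "perp Q v UNIV"
  have K: "vec.subspace ?K"
    by (intro subspace_perp) auto
  have V': "CARD('a ^ 'n) = CARD('a) ^ ((n + 1) + 2)"
    using V by (simp add: numeral_eq_Suc)
  note red = card_zeros_reduction[OF vec.subspace_UNIV V' UNIV_I v UNIV_I w0]
  show ?thesis
  proof (cases "\<exists>x\<in>?K. Q x \<noteq> 0")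
    case True
    then obtain x where "x \<in> ?K" "Q x \<noteq> 0"
      by auto
    from card_zeros_le[OF K _ this, of n] red show ?thesis
      by simp
  next
    case False
    define w where "w = (1 / polar Q v w0) *s w0"
    have w: "polar Q v w = 1"
      using w0 by (simp add: w_def polar_linear)
    \<comment> \<open>The cofactor comes from expanding \<open>Q (x - polar Q v x *s w) = 0\<close>,
      where the argument lies in the hyperplane because \<open>polar Q v w = 1\<close>.\<close>
    let ?m = "\<lambda>x. polar Q w x + (- Q w) * polar Q v x"
    have "Q x = polar Q v x * ?m x" for x
    proof -
      let ?k = "x - polar Q v x *s w"
      have "?k \<in> ?K"
        by (simp add: perp_def polar_linear w)
      then have "Q ?k = 0"
        using False by blast
      then have "Q x + (polar Q v x)^2 * Q w - polar Q v x * polar Q w x = 0"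
        unfolding Q_diff_multiple by (simp add: polar_commute[of x])
      then show ?thesis
        by (simp add: power2_eq_square algebra_simps)
    qed
    moreover have "functional ?m"
      by (intro functional_add functional_scale functional_polar)
    ultimately have "\<exists>l m. functional l \<and> functional m \<and> (\<forall>x. Q x = l x * m x)"
      using functional_polar by blast
    then show ?thesis ..
  qed
next
  case False
  show ?thesis
  proof (cases "\<exists>x. Q x \<noteq> 0")
    case True
    then obtain x where x: "Q x \<noteq> 0"
      by blast
    have "vec.subspace (zeros Q UNIV)"
      using False by (intro subspace_zeros) auto
    then have "CARD('a) * card (zeros Q UNIV) \<le> CARD('a ^ 'n)"
      by (rule card_psubspace_le[OF _ vec.subspace_UNIV _ UNIV_I]) (use x in \<open>auto simp: zeros_def\<close>)
    then have "CARD('a) * card (zeros Q UNIV) \<le> CARD('a) * CARD('a) ^ (n + 2)"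
      using V by (simp add: numeral_eq_Suc)
    then have "card (zeros Q UNIV) \<le> CARD('a) ^ (n + 2)"
      by simp
    moreover have "CARD('a) ^ n \<le> CARD('a) ^ (n + 1)"
      by (intro power_increasing) auto
    ultimately have "card (zeros Q UNIV) + CARD('a) ^ n \<le> CARD('a) ^ (n + 2) + CARD('a) ^ (n + 1)"
      by linarith
    then show ?thesis ..
  next
    case False
    then have "functional (\<lambda>x :: 'a ^ 'n. 0 :: 'a) \<and> (\<forall>x. Q x = 0 * 0)"
      by (simp add: functional_def)
    then show ?thesis by blast
  qed
qed

section \<open>Nondegenerate quadratic maps in five dimensions\<close>

text \<open>Only nonzero zeros of \<open>Q\<close> are kept out of the radical of the polar form.
  The radical itself cannot be required to be trivial: in characteristic 2 an alternating form in
  odd dimension is degenerate. Dimension 5 is expressed by cardinality.\<close>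

locale nondegenerate_quadratic = finite_quadratic Q
  for Q :: "'a::{field,finite} ^ 'n::finite \<Rightarrow> 'a" +
  assumes card_V: "CARD('a ^ 'n) = CARD('a) ^ 5"
    and nonsingular: "Q v = 0 \<Longrightarrow> v \<noteq> 0 \<Longrightarrow> \<exists>w. polar Q v w \<noteq> 0"

text \<open>The tangent hyperplane determines the point: the inclusion makes
  \<open>polar Q u\<close> a multiple \<open>c\<close> of \<open>polar Q v\<close>, so
  \<open>u - c *s v\<close> is a zero in the radical and must be 0.\<close>

lemma (in nondegenerate_quadratic) perp_subset_multiple:
  assumes v: "Q v = 0" "v \<noteq> 0" and u: "Q u = 0" and sub: "perp Q v UNIV \<subseteq> perp Q u UNIV"
  shows "\<exists>c. u = c *s v"
proof -
  obtain w where w: "polar Q v w \<noteq> 0"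
    using nonsingular[OF v] by blast
  define c where "c = polar Q u w / polar Q v w"
  have *: "polar Q u x = c * polar Q v x" for x
  proof -
    have "x - (polar Q v x / polar Q v w) *s w \<in> perp Q v UNIV"
      using w by (simp add: perp_def polar_linear)
    then have "x - (polar Q v x / polar Q v w) *s w \<in> perp Q u UNIV"
      using sub by blast
    then show ?thesis
      using w by (simp add: perp_def polar_linear c_def)
  qed
  have "Q (u - c *s v) = 0"
    using u v * by (simp add: Q_diff_multiple polar_self)
  moreover have "polar Q (u - c *s v) x = 0" for x
    by (simp add: polar_linear *)
  ultimately have "u - c *s v = 0"
    using nonsingular by blast
  then show ?thesis by auto
qed

text \<open>Two vectors \<open>a\<close> and \<open>b\<close> complete \<open>S\<close> to the whole
  space. Orthogonality to both imposes two linear conditions on a space of size q^3, so some nonzero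
  \<open>p\<close> in \<open>S\<close> satisfies them. If \<open>S\<close> is totally singular, this
  \<open>p\<close> is a zero orthogonal to everything.\<close>

lemma (in nondegenerate_quadratic) not_totally_singular:
  assumes S: "vec.subspace S" "card S = CARD('a) ^ 3"
  shows "\<exists>x\<in>S. Q x \<noteq> 0"
proof (rule ccontr)
  assume "\<not> ?thesis"
  then have Q0: "Q x = 0" if "x \<in> S" for x
    using that by blast
  have polar0: "polar Q x y = 0" if "x \<in> S" "y \<in> S" for x y
    using that vec.subspace_add[OF S(1)] by (simp add: polar_def Q0)
  let ?q = "CARD('a)"
  have q: "2 \<le> ?q" by (rule two_le_card_field)
  have "S \<noteq> UNIV"
    using S(2) card_V q by (auto simp: power_inject_exp)
  then obtain a where a: "a \<notin> S" by blast
  let ?T = "adjoin S a"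
  have T: "vec.subspace ?T" "card ?T = ?q ^ 4"
    using subspace_adjoin[OF S(1)] card_adjoin[OF S(1) a] S(2) by (auto simp flip: power_Suc)
  then have "?T \<noteq> UNIV"
    using card_V q by auto
  then obtain b where b: "b \<notin> ?T" by blast
  have "card (adjoin ?T b) = CARD('a ^ 'n)"
    using card_adjoin[OF T(1) b] T(2) card_V by (simp flip: power_Suc)
  then have V: "adjoin ?T b = UNIV"
    by (intro card_subset_eq) auto
  have "?q * ?q ^ 2 \<le> ?q * card (perp Q a S)"
    using card_perp_ge[OF S(1), of a] S(2) by (simp only: power_Suc[symmetric]) simp
  then have "?q * ?q \<le> card (perp Q a S)"
    by (simp add: power2_eq_square)
  then have "?q * ?q \<le> ?q * card (perp Q b (perp Q a S))"
    using card_perp_ge[OF subspace_perp[OF S(1)]] by (rule le_trans)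
  then have "1 < card (perp Q b (perp Q a S))"
    using q by simp
  then obtain p where p: "p \<in> perp Q b (perp Q a S)" "p \<noteq> 0"
    using ex_nonzero by blast
  then have pS: "p \<in> S" and pab: "polar Q p a = 0" "polar Q p b = 0"
    by (auto simp: perp_def polar_commute[of p])
  have "polar Q p x = 0" for x
  proof -
    have "x \<in> adjoin ?T b"
      using V by simp
    then obtain s c d where "x = (s + c *s a) + d *s b" "s \<in> S"
      by (auto simp: adjoin_def)
    then show ?thesis
      using pS pab by (simp add: polar_linear polar0)
  qed
  then show False
    using nonsingular[OF Q0[OF pS] p(2)] by blast
qed

text \<open>The tangent hyperplane section is a cone over a conic. The reduction is applied at
  \<open>v\<close> and then, inside the tangent hyperplane, at a second zero \<open>u\<close>. This
  leaves a space of size q^3 spanned by the totally singular \<open>v\<close>, \<open>u\<close> and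
  a vector \<open>e\<close> with \<open>Q e \<noteq> 0\<close>; its zeros are exactly the span of
  \<open>v\<close> and \<open>u\<close>.\<close>

lemma (in nondegenerate_quadratic) card_zeros_singular:
  assumes v: "Q v = 0" "v \<noteq> 0"
  shows "card (perp Q v UNIV) = CARD('a) ^ 4"
    and "card (zeros Q (perp Q v UNIV)) = CARD('a) ^ 3"
    and "card (zeros Q UNIV) = CARD('a) ^ 4"
proof -
  let ?q = "CARD('a)" and ?P = "perp Q v UNIV"
  obtain w where w: "polar Q v w \<noteq> 0"
    using nonsingular[OF v] by blast
  have V: "CARD('a ^ 'n) = ?q ^ (3 + 2)"
    using card_V by simp
  note red = card_zeros_reduction[OF vec.subspace_UNIV V UNIV_I v(1) UNIV_I w]
  show P: "card ?P = ?q ^ 4"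
    using red(1) by simp
  have sP: "vec.subspace ?P"
    by (intro subspace_perp) auto
  have vP: "v \<in> ?P"
    using v by (simp add: perp_def polar_self)
  have "?q * ?q ^ 3 \<le> ?q * card (perp Q w ?P)"
    using card_perp_ge[OF sP, of w] P by (simp only: power_Suc[symmetric]) simp
  then have "?q ^ 3 \<le> card (perp Q w ?P)"
    by simp
  then obtain u where u: "u \<in> perp Q w ?P" "u \<noteq> 0" "Q u = 0"
    using ex_nontrivial_zero[OF subspace_perp[OF sP]] by blast
  \<comment> \<open>The vector \<open>u\<close> was sought orthogonal to \<open>w\<close> for this
    purpose: \<open>v\<close> is not orthogonal to \<open>w\<close>, so no nonzero multiple of
    \<open>v\<close> is.\<close>
  have nm: "u \<noteq> c *s v" for c
    using u w by (auto simp: perp_def polar_linear polar_commute[of w])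
  then obtain x where x: "x \<in> ?P" "polar Q u x \<noteq> 0"
    using perp_subset_multiple[OF v u(3)] by (auto simp: perp_def)
  have uP: "u \<in> ?P"
    using u by (simp add: perp_def)
  let ?T = "perp Q u ?P"
  have P': "card ?P = ?q ^ (2 + 2)"
    using P by simp
  note red2 = card_zeros_reduction[OF sP P' uP u(3) x]
  have sT: "vec.subspace ?T"
    by (intro subspace_perp sP)
  have T: "card ?T = ?q ^ 3"
    using red2(1) by simp
  obtain e where e: "e \<in> ?T" "Q e \<noteq> 0"
    using not_totally_singular[OF sT T] by blast
  let ?L1 = "adjoin {0} v"
  let ?L = "adjoin ?L1 u"
  have s1: "vec.subspace ?L1" and sL: "vec.subspace ?L"
    by (intro subspace_adjoin; simp)+
  have c1: "card ?L1 = ?q"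
    using v by (subst card_adjoin) auto
  have "u \<notin> ?L1"
    using nm by (auto simp: adjoin_def)
  then have cL: "card ?L = ?q ^ 2"
    using c1 by (subst card_adjoin[OF s1]) (auto simp: power2_eq_square)
  have uv: "polar Q v u = 0"
    using uP by (simp add: perp_def)
  have LQ: "Q y = 0" if "y \<in> ?L" for y
    using that v(1) u(3) uv by (auto simp: adjoin_def Q_add Q_scale polar_linear)
  have LT: "polar Q y z = 0" if "y \<in> ?L" "z \<in> ?T" for y z
    using that by (auto simp: adjoin_def polar_linear perp_def)
  have "v \<in> ?T"
    using vP uv by (simp add: perp_def polar_commute[of u])
  moreover have "u \<in> ?T"
    using uP u(3) by (simp add: perp_def polar_self)
  ultimately have LsT: "?L \<subseteq> ?T"
    using vec.subspace_0[OF sT] by (intro adjoin_subset sT) auto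
  have "e \<notin> ?L"
    using LQ e by blast
  then have "card (adjoin ?L e) = ?q ^ 3"
    using cL by (subst card_adjoin[OF sL]) (auto simp: power2_eq_square power3_eq_cube)
  then have TL: "adjoin ?L e = ?T"
    using T adjoin_subset[OF sT LsT e(1)] by (intro card_subset_eq) auto
  have "zeros Q ?T = ?L"
  proof
    show "?L \<subseteq> zeros Q ?T"
      using LsT LQ by (auto simp: zeros_def)
    show "zeros Q ?T \<subseteq> ?L"
    proof
      fix z assume z: "z \<in> zeros Q ?T"
      then have "z \<in> adjoin ?L e"
        using TL by (simp add: zeros_def)
      then obtain y c where y: "z = y + c *s e" "y \<in> ?L"
        unfolding adjoin_def[of ?L] by blast
      then have "Q z = c^2 * Q e"
        using LQ LT[OF _ e(1)] by (simp add: Q_add Q_scale polar_linear)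
      then have "c = 0"
        using z e by (simp add: zeros_def)
      then show "z \<in> ?L"
        using y by simp
    qed
  qed
  then show zP: "card (zeros Q ?P) = ?q ^ 3"
    using red2(2) cL by simp
  then show "card (zeros Q UNIV) = ?q ^ 4"
    using red(2) by simp
qed

lemma (in nondegenerate_quadratic) ex_zero: "\<exists>v. v \<noteq> 0 \<and> Q v = 0"
proof -
  have "CARD('a) ^ 3 \<le> CARD('a) ^ 5"
    using two_le_card_field[where 'a = 'a] by (intro power_increasing) auto
  then show ?thesis
    using ex_nontrivial_zero[OF vec.subspace_UNIV] card_V by auto
qed

lemma (in nondegenerate_quadratic) card_zeros: "card (zeros Q UNIV) = CARD('a) ^ 4"
  using ex_zero card_zeros_singular(3) by blast

lemma (in nondegenerate_quadratic) card_zeros_tangent: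
  assumes "card H = CARD('a) ^ 4" and v: "Q v = 0" "v \<noteq> 0"
    and "\<And>x. x \<in> H \<Longrightarrow> polar Q v x = 0"
  shows "card (zeros Q H) = CARD('a) ^ 3"
proof -
  have "H = perp Q v UNIV"
    using assms card_zeros_singular(1)[OF v] by (intro card_subset_eq) (auto simp: perp_def)
  then show ?thesis
    using card_zeros_singular(2)[OF v] by simp
qed

text \<open>A tangent hyperplane has q^3 zeros. For any other, the reduction leaves a space of size
  q^3 that is not totally singular and has at most 2q^2 - q zeros. The bound is the size of a
  hyperbolic section, which has (q + 1)^2 projective points.\<close>

lemma (in nondegenerate_quadratic) card_zeros_hyperplane_le:
  assumes H: "vec.subspace H" "card H = CARD('a) ^ 4"
  shows "card (zeros Q H) + CARD('a) \<le> CARD('a) ^ 3 + CARD('a) ^ 2"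
proof -
  let ?q = "CARD('a)"
  have q: "2 \<le> ?q" by (rule two_le_card_field)
  have "?q ^ 3 \<le> card H"
    unfolding H(2) using q by (intro power_increasing) auto
  then obtain v where v: "v \<in> H" "v \<noteq> 0" "Q v = 0"
    using ex_nontrivial_zero[OF H(1)] by blast
  show ?thesis
  proof (cases "\<exists>w\<in>H. polar Q v w \<noteq> 0")
    case True
    then obtain w where w: "w \<in> H" "polar Q v w \<noteq> 0"
      by blast
    have "card H = ?q ^ (2 + 2)"
      using H by simp
    note red = card_zeros_reduction[OF H(1) this v(1,3) w]
    let ?P = "perp Q v H"
    have P: "vec.subspace ?P" "card ?P = ?q ^ 3"
      using red(1) subspace_perp[OF H(1)] by auto
    obtain x where x: "x \<in> ?P" "Q x \<noteq> 0"
      using not_totally_singular[OF P] by blast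
    have "card (zeros Q ?P) + ?q ^ 1 \<le> 2 * ?q ^ (1 + 1)"
      by (rule card_zeros_le[OF P(1) _ x]) (use P in \<open>simp add: eval_nat_numeral\<close>)
    then have "card (zeros Q ?P) + ?q \<le> 2 * ?q ^ 2"
      by (simp add: power2_eq_square)
    moreover have "card (zeros Q H) + ?q ^ 2 = ?q ^ 3 + card (zeros Q ?P)"
      using red(2) by simp
    ultimately show ?thesis by linarith
  next
    case False
    then have "card (zeros Q H) = ?q ^ 3"
      by (intro card_zeros_tangent[OF H(2) v(3,2)]) auto
    then show ?thesis
      by (simp add: power2_eq_square)
  qed
qed

text \<open>Let \<open>v\<close> be a nonzero zero in \<open>P\<close>. If \<open>v\<close> were not
  orthogonal to \<open>P\<close>, the reduction would give q^2 - q zeros in \<open>P\<close> besides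
  at least the q multiples of \<open>v\<close>, against \<open>few\<close>. So \<open>P\<close> is
  the hyperplane of \<open>H\<close> orthogonal to \<open>v\<close>, unless \<open>H\<close> is
  tangent at \<open>v\<close>, and the reduction transfers the small count from \<open>P\<close> to
  \<open>H\<close>.\<close>

lemma (in nondegenerate_quadratic) card_zeros_hyperplane_le_cube:
  assumes H: "vec.subspace H" "card H = CARD('a) ^ 4"
    and P: "vec.subspace P" "P \<subseteq> H" "card P = CARD('a) ^ 3"
    and few: "card (zeros Q P) < CARD('a) ^ 2"
  shows "card (zeros Q H) \<le> CARD('a) ^ 3"
proof -
  let ?q = "CARD('a)"
  obtain v where v: "v \<in> P" "v \<noteq> 0" "Q v = 0"
    using ex_nontrivial_zero[OF P(1)] P(3) by auto
  have P_perp: "polar Q v w = 0" if w: "w \<in> P" for w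
  proof (rule ccontr)
    assume nz: "polar Q v w \<noteq> 0"
    note red = card_zeros_reduction[OF P(1) _ v(1,3) w nz, of 1, unfolded one_plus_numeral, simplified]
    have "range (\<lambda>c. c *s v) \<subseteq> zeros Q (perp Q v P)"
      using v vec.subspace_scale[OF P(1)]
      by (auto simp: zeros_def perp_def Q_scale polar_linear polar_self)
    then have "?q \<le> card (zeros Q (perp Q v P))"
      using card_multiples[OF v(2)] card_mono[OF finite] by metis
    moreover have "card (zeros Q P) + ?q = ?q ^ 2 + card (zeros Q (perp Q v P))"
      using red(2) P(3) by (simp add: power2_eq_square)
    ultimately show False
      using few by linarith
  qed
  show ?thesis
  proof (cases "\<exists>w\<in>H. polar Q v w \<noteq> 0")
    case True
    then obtain w where w: "w \<in> H" "polar Q v w \<noteq> 0"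
      by blast
    have vH: "v \<in> H"
      using v P by blast
    have "card H = ?q ^ (2 + 2)"
      using H by simp
    note red = card_zeros_reduction[OF H(1) this vH v(3) w]
    have "P = perp Q v H"
      using P P_perp red(1) by (intro card_subset_eq) (auto simp: perp_def)
    then have "card (zeros Q H) + ?q ^ 2 = ?q ^ 3 + card (zeros Q P)"
      using red(2) by simp
    then show ?thesis
      using few by linarith
  next
    case False
    then have "card (zeros Q H) = ?q ^ 3"
      by (intro card_zeros_tangent[OF H(2) v(3,2)]) auto
    then show ?thesis by simp
  qed
qed

lemma (in nondegenerate_quadratic) card_functional_kernel:
  fixes l :: "'a ^ 'n \<Rightarrow> 'a"
  assumes "functional l" "l x \<noteq> 0"
  shows "card {x. l x = 0} = CARD('a) ^ 4"
proof -
  have "CARD('a) * card {x. l x = 0} = CARD('a) * CARD('a) ^ 4"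
    using card_kernel[OF assms(1) vec.subspace_UNIV UNIV_I assms(2)] card_V
    by (simp flip: power_Suc)
  then show ?thesis by simp
qed

text \<open>Inclusion and exclusion for two hyperplanes. At least q^2 zeros in the intersection
  compensate for two large sections; with fewer, each section has at most q^3 zeros, and 2q \<le>
  q^2 closes the gap. Equal hyperplanes count only once.\<close>

lemma (in nondegenerate_quadratic) card_zeros_product_le:
  assumes l: "functional l" "l x \<noteq> 0" and m: "functional m" "m y \<noteq> 0"
  shows "card {x. Q x = 0 \<and> l x * m x = 0} + 2 * CARD('a) \<le> 2 * CARD('a) ^ 3 + CARD('a) ^ 2"
proof -
  let ?q = "CARD('a)" and ?H = "{x. l x = 0}" and ?K = "{x. m x = 0}"
  let ?P = "{x \<in> ?H. m x = 0}"
  have q: "2 \<le> ?q" by (rule two_le_card_field)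
  have q2: "2 * ?q \<le> ?q ^ 2"
    using q by (simp add: power2_eq_square)
  have sH: "vec.subspace ?H" and sK: "vec.subspace ?K"
    using subspace_kernel[OF l(1) vec.subspace_UNIV] subspace_kernel[OF m(1) vec.subspace_UNIV]
    by auto
  have cH: "card ?H = ?q ^ 4" and cK: "card ?K = ?q ^ 4"
    using card_functional_kernel l m by blast+
  have H: "card (zeros Q ?H) + ?q \<le> ?q ^ 3 + ?q ^ 2"
    by (rule card_zeros_hyperplane_le[OF sH cH])
  have K: "card (zeros Q ?K) + ?q \<le> ?q ^ 3 + ?q ^ 2"
    by (rule card_zeros_hyperplane_le[OF sK cK])
  have U: "{x. Q x = 0 \<and> l x * m x = 0} = zeros Q ?H \<union> zeros Q ?K"
    by (auto simp: zeros_def)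
  have I: "zeros Q ?H \<inter> zeros Q ?K = zeros Q ?P"
    by (auto simp: zeros_def)
  have UI: "card {x. Q x = 0 \<and> l x * m x = 0} + card (zeros Q ?P) =
      card (zeros Q ?H) + card (zeros Q ?K)"
    using card_Un_Int[of "zeros Q ?H" "zeros Q ?K"] by (simp only: U I finite)
  show ?thesis
  proof (cases "\<exists>z\<in>?H. m z \<noteq> 0")
    case True
    then obtain z where z: "z \<in> ?H" "m z \<noteq> 0"
      by blast
    have sP: "vec.subspace ?P"
      by (rule subspace_kernel[OF m(1) sH])
    have "?q * card ?P = ?q * ?q ^ 3"
      using card_kernel[OF m(1) sH z] cH by (simp flip: power_Suc)
    then have cP: "card ?P = ?q ^ 3"
      by simp
    show ?thesis
    proof (cases "card (zeros Q ?P) < ?q ^ 2")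
      case True
      have "card (zeros Q ?H) \<le> ?q ^ 3"
        by (rule card_zeros_hyperplane_le_cube[OF sH cH sP _ cP True]) auto
      moreover have "card (zeros Q ?K) \<le> ?q ^ 3"
        by (rule card_zeros_hyperplane_le_cube[OF sK cK sP _ cP True]) auto
      ultimately show ?thesis
        using UI q2 by linarith
    next
      case False
      then show ?thesis
        using UI H K by linarith
    qed
  next
    case False
    then have "?H = ?K"
      using cH cK by (intro card_subset_eq) auto
    then have "{x. Q x = 0 \<and> l x * m x = 0} = zeros Q ?H"
      using U by simp
    moreover have "?q ^ 1 \<le> ?q ^ 3"
      using q by (intro power_increasing) auto
    ultimately show ?thesis
      using H by simp
  qed
qed

text \<open>Counts the members of the pencil spanned by \<open>f\<close> and \<open>Q\<close> through each vector: all of them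
  for a base point, exactly one otherwise.\<close>

lemma (in nondegenerate_quadratic) sum_card_zeros_pencil:
  shows "(\<Sum>c\<in>UNIV. card (zeros (\<lambda>v. f v + c * Q v) UNIV)) + CARD('a) ^ 4 =
    CARD('a) ^ 5 + CARD('a) * card {v. Q v = 0 \<and> f v = 0}"
proof -
  let ?q = "CARD('a)" and ?M = "{v. Q v = 0 \<and> f v = 0}"
  have count: "card {c. f v + c * Q v = 0} =
      (if v \<in> - zeros Q UNIV then 1 else 0) + (if v \<in> ?M then ?q else 0)" for v
  proof (cases "Q v = 0")
    case False
    then have "{c. f v + c * Q v = 0} = {- f v / Q v}"
      by (auto simp: field_simps add_eq_0_iff2)
    then show ?thesis
      using False by (simp add: zeros_def)
  qed (auto simp: zeros_def)
  have "(\<Sum>c\<in>UNIV. card (zeros (\<lambda>v. f v + c * Q v) UNIV)) =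
      (\<Sum>c\<in>UNIV. \<Sum>v\<in>UNIV. if f v + c * Q v = 0 then 1 else 0)"
    by (simp add: zeros_def sum.If_cases)
  also have "\<dots> = (\<Sum>v\<in>UNIV. \<Sum>c\<in>UNIV. if f v + c * Q v = 0 then 1 else 0)"
    by (rule sum.swap)
  also have "\<dots> = (\<Sum>v\<in>UNIV. card {c. f v + c * Q v = 0})"
    by (simp add: sum.If_cases)
  also have "\<dots> = card (- zeros Q UNIV) + ?q * card ?M"
    unfolding count sum.distrib by (simp add: sum.If_cases Compl_eq)
  also have "card (- zeros Q UNIV) = ?q ^ 5 - ?q ^ 4"
    by (simp add: Compl_eq_Diff_UNIV card_Diff_subset card_V[simplified] card_zeros)
  finally have "(\<Sum>c\<in>UNIV. card (zeros (\<lambda>v. f v + c * Q v) UNIV)) = ?q ^ 5 - ?q ^ 4 + ?q * card ?M" .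
  moreover have "?q ^ 4 \<le> ?q ^ 5"
    using two_le_card_field[where 'a = 'a] by (intro power_increasing) auto
  ultimately show ?thesis by linarith
qed

text \<open>A split member of the pencil may replace \<open>f\<close> on the zeros of
  \<open>Q\<close>. If none splits, each of the q members \<open>f + c * Q\<close> has at most q^4 +
  q^3 - q^2 zeros, and the pencil count turns the sum of these bounds into one for the common
  zeros.\<close>

lemma (in nondegenerate_quadratic) pencil_cases:
  assumes f: "quadratic f" and nm: "\<And>c. \<exists>v. f v \<noteq> c * Q v"
  shows "card {v. Q v = 0 \<and> f v = 0} + CARD('a) ^ 2 \<le> 2 * CARD('a) ^ 3 \<or>
    (\<exists>l m x y. functional l \<and> functional m \<and> l x \<noteq> 0 \<and> m y \<noteq> 0 \<and>
      {v. Q v = 0 \<and> f v = 0} = {v. Q v = 0 \<and> l v * m v = 0})"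
proof (cases "\<exists>c l m. functional l \<and> functional m \<and> (\<forall>v. f v + c * Q v = l v * m v)")
  case True
  then obtain c l m where lm: "functional l" "functional m" "\<And>v. f v + c * Q v = l v * m v"
    by blast
  \<comment> \<open>Since \<open>f\<close> is not a multiple of \<open>Q\<close>, the product is not
    identically zero, which makes both factors nonzero.\<close>
  obtain v where v: "f v \<noteq> (- c) * Q v"
    using nm by blast
  then have "l v \<noteq> 0" "m v \<noteq> 0"
    using lm(3)[of v] by (auto simp: add_eq_0_iff2)
  moreover have "{v. Q v = 0 \<and> f v = 0} = {v. Q v = 0 \<and> l v * m v = 0}"
    unfolding lm(3)[symmetric] by auto
  ultimately show ?thesis
    using lm(1,2) by blast
next
  case False
  let ?q = "CARD('a)"
  have "card (zeros (\<lambda>v. f v + c * Q v) UNIV) + ?q ^ 2 \<le> ?q ^ 4 + ?q ^ 3" for c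
  proof -
    interpret g: finite_quadratic "\<lambda>v. f v + c * Q v"
      unfolding finite_quadratic_def by (intro quadratic_pencil f quadratic_axioms)
    show ?thesis
      using g.product_or_card_zeros_le[of 2] card_V False by auto
  qed
  then have "(\<Sum>c\<in>(UNIV :: 'a set). card (zeros (\<lambda>v. f v + c * Q v) UNIV) + ?q ^ 2) \<le>
      (\<Sum>c\<in>(UNIV :: 'a set). ?q ^ 4 + ?q ^ 3)"
    by (intro sum_mono)
  then have "(\<Sum>c\<in>UNIV. card (zeros (\<lambda>v. f v + c * Q v) UNIV)) + ?q * ?q ^ 2 \<le>
      ?q * ?q ^ 4 + ?q * ?q ^ 3"
    by (simp add: sum.distrib distrib_left)
  then have "?q * (card {v. Q v = 0 \<and> f v = 0} + ?q ^ 2) \<le> ?q * (2 * ?q ^ 3)"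
    using sum_card_zeros_pencil[of f] by (simp add: distrib_left mult.left_commute[of _ 2] flip: power_Suc)
  then show ?thesis by simp
qed

lemma (in nondegenerate_quadratic) card_common_zeros_le:
  assumes f: "quadratic f" and nm: "\<And>c. \<exists>v. f v \<noteq> c * Q v"
  shows "card {v. Q v = 0 \<and> f v = 0} + 2 * CARD('a) \<le> 2 * CARD('a) ^ 3 + CARD('a) ^ 2"
  using pencil_cases[OF assms]
proof
  assume "card {v. Q v = 0 \<and> f v = 0} + CARD('a) ^ 2 \<le> 2 * CARD('a) ^ 3"
  moreover have "2 * CARD('a) \<le> CARD('a) ^ 2"
    using two_le_card_field[where 'a = 'a] by (simp add: power2_eq_square)
  ultimately show ?thesis by linarith
next
  assume "\<exists>l m x y. functional l \<and> functional m \<and> l x \<noteq> 0 \<and> m y \<noteq> 0 \<and>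
      {v. Q v = 0 \<and> f v = 0} = {v. Q v = 0 \<and> l v * m v = 0}"
  then obtain l m x y where lm: "functional l" "l x \<noteq> 0" "functional m" "m y \<noteq> 0"
    and eq: "{v. Q v = 0 \<and> f v = 0} = {v. Q v = 0 \<and> l v * m v = 0}"
    by blast
  show ?thesis
    unfolding eq by (rule card_zeros_product_le[OF lm])
qed

text \<open>The bound of \<open>card_common_zeros_le\<close> is no help for q = 2, where it equals
  q^4. The sharper first case of \<open>pencil_cases\<close> is excluded by counting, so a product
  \<open>l v * m v\<close> would vanish on all zeros of \<open>Q\<close>. This is refuted by showing
  that a suitable tangent hyperplane would meet the kernel of \<open>l\<close> in a totally singular
  space of size q^3.\<close>

lemma (in nondegenerate_quadratic) multiple_if_vanishes_on_zeros:
  assumes f: "quadratic f" and van: "\<And>v. Q v = 0 \<Longrightarrow> f v = 0"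
  shows "\<exists>c. \<forall>v. f v = c * Q v"
proof (rule ccontr)
  assume "\<not> ?thesis"
  then have nm: "\<exists>v. f v \<noteq> c * Q v" for c
    by blast
  let ?q = "CARD('a)"
  have q: "2 \<le> ?q" by (rule two_le_card_field)
  have Z: "{v. Q v = 0 \<and> f v = 0} = zeros Q UNIV"
    using van by (auto simp: zeros_def)
  have "2 * ?q ^ 3 \<le> ?q * ?q ^ 3"
    using q by (rule mult_right_mono) simp
  then have "2 * ?q ^ 3 \<le> ?q ^ 4" "0 < ?q ^ 2"
    by (simp_all flip: power_Suc)
  then have "\<not> card {v. Q v = 0 \<and> f v = 0} + ?q ^ 2 \<le> 2 * ?q ^ 3"
    unfolding Z card_zeros by linarith
  with pencil_cases[OF f nm] obtain l m x0 y0 where l: "functional l" "l x0 \<noteq> 0"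
    and m: "functional m" "m y0 \<noteq> 0" and Zlm: "zeros Q UNIV = {v. Q v = 0 \<and> l v * m v = 0}"
    unfolding Z by blast
  have lm: "l v * m v = 0" if "Q v = 0" for v
  proof -
    have "v \<in> zeros Q UNIV"
      using that by (simp add: zeros_def)
    then show ?thesis
      unfolding Zlm by blast
  qed
  let ?H = "{x. l x = 0}" and ?K = "{x. m x = 0}"
  let ?D = "zeros Q UNIV - zeros Q ?K"
  have sK: "vec.subspace ?K"
    using subspace_kernel[OF m(1) vec.subspace_UNIV] by simp
  have cH: "card ?H = ?q ^ 4" and cK: "card ?K = ?q ^ 4"
    using card_functional_kernel l m by blast+
  have "card ?D = ?q ^ 4 - card (zeros Q ?K)"
    using card_zeros by (subst card_Diff_subset) (auto simp: zeros_def)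
  moreover have "card (zeros Q ?K) + ?q \<le> ?q ^ 3 + ?q ^ 2"
    by (rule card_zeros_hyperplane_le[OF sK cK])
  moreover have "?q ^ 3 + ?q ^ 2 < ?q ^ 4"
  proof -
    have "?q ^ 2 < ?q ^ 3"
      using q by (intro power_strict_increasing) auto
    then show ?thesis
      using \<open>2 * ?q ^ 3 \<le> ?q ^ 4\<close> by linarith
  qed
  \<comment> \<open>More than q zeros lie off the kernel of \<open>m\<close>, so two of them are not
    proportional; these have different tangent hyperplanes, and at most one of those is
    \<open>?H\<close>.\<close>
  ultimately have D: "?q < card ?D"
    by linarith
  have "?D \<noteq> {}"
    using D by (metis card.empty not_less_zero)
  then obtain v1 where v1: "v1 \<in> ?D"
    by blast
  obtain v2 where v2: "v2 \<in> ?D" "\<And>c. v2 \<noteq> c *s v1"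
    using ex_not_multiple[OF D] by blast
  have Dnz: "v \<noteq> 0 \<and> Q v = 0 \<and> m v \<noteq> 0" if "v \<in> ?D" for v
    using that functionalD(3)[OF m(1)] by (auto simp: zeros_def)
  have "perp Q v1 UNIV \<noteq> ?H \<or> perp Q v2 UNIV \<noteq> ?H"
    using perp_subset_multiple[of v1 v2] Dnz[OF v1] Dnz[OF v2(1)] v2(2) by blast
  then obtain v where v: "v \<noteq> 0" "Q v = 0" "m v \<noteq> 0" "perp Q v UNIV \<noteq> ?H"
    using Dnz v1 v2 by blast
  have lv: "l v = 0"
    using lm v by fastforce
  let ?P = "perp Q v UNIV"
  have sP: "vec.subspace ?P"
    by (intro subspace_perp) auto
  have cP: "card ?P = ?q ^ 4" and zP: "card (zeros Q ?P) = ?q ^ 3"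
    using card_zeros_singular[OF v(2,1)] by auto
  have "\<not> ?P \<subseteq> ?H"
    using cP cH v(4) card_subset_eq[of ?H ?P] by auto
  then obtain w where w: "w \<in> ?P" "l w \<noteq> 0"
    by blast
  let ?E = "{x \<in> ?P. l x = 0}"
  have "?q * card ?E = ?q * ?q ^ 3"
    using card_kernel[OF l(1) sP w] cP by (simp flip: power_Suc)
  then have cE: "card ?E = ?q ^ 3"
    by simp
  \<comment> \<open>For a zero \<open>u\<close> in the tangent hyperplane at \<open>v\<close>,
    \<open>u + v\<close> is a zero too. Comparing the product at \<open>u\<close> and at
    \<open>u + v\<close>, with \<open>l v = 0\<close> and \<open>m v \<noteq> 0\<close>, forces
    \<open>l u = 0\<close>.\<close>
  have "zeros Q ?P \<subseteq> ?E"
  proof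
    fix u assume u: "u \<in> zeros Q ?P"
    then have "Q (u + v) = 0"
      using v by (simp add: zeros_def perp_def Q_add polar_commute[of u])
    from lm[OF this] have "l u * (m u + m v) = 0"
      using lv l m by (simp add: functionalD)
    moreover have "l u * m u = 0"
      using u by (intro lm) (simp add: zeros_def)
    ultimately have "l u = 0"
      using v(3) by (auto simp: distrib_left)
    then show "u \<in> ?E"
      using u by (simp add: zeros_def)
  qed
  then have "zeros Q ?P = ?E"
    using zP cE by (intro card_subset_eq) auto
  moreover obtain x where "x \<in> ?E" "Q x \<noteq> 0"
    using not_totally_singular[OF subspace_kernel[OF l(1) sP] cE] by blast
  ultimately show False
    by (auto simp: zeros_def)
qed

section \<open>Normal form and extremal pairs of hyperplanes\<close>

text \<open>Scale \<open>w\<close> to pairing 1 with \<open>u\<close>, then subtract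
  \<open>Q w'\<close> times \<open>u\<close>. This cancels the value of \<open>Q\<close> and keeps
  the pairing, since \<open>u\<close> is orthogonal to itself.\<close>

lemma (in quadratic) hyperbolic_partner:
  assumes S: "vec.subspace S" and u: "u \<in> S" "Q u = 0" and w: "w \<in> S" "polar Q u w \<noteq> 0"
  shows "\<exists>v\<in>S. Q v = 0 \<and> polar Q u v = 1"
proof -
  define w' where "w' = (1 / polar Q u w) *s w"
  have w': "w' \<in> S" "polar Q u w' = 1"
    using w vec.subspace_scale[OF S] by (auto simp: w'_def polar_linear)
  have "w' - Q w' *s u \<in> S"
    using w' u vec.subspace_diff[OF S] vec.subspace_scale[OF S] by simp
  moreover have "Q (w' - Q w' *s u) = 0"
    using w' u by (simp add: Q_diff_multiple polar_commute[of w'])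
  moreover have "polar Q u (w' - Q w' *s u) = 1"
    using w' u by (simp add: polar_linear polar_self)
  ultimately show ?thesis by blast
qed

text \<open>Two hyperbolic pairs \<open>e0\<close>, \<open>e1\<close> and \<open>e2\<close>,
  \<open>e3\<close> are split off, and a vector \<open>e4\<close> orthogonal to all four remains.
  Its value \<open>a\<close> is nonzero, since otherwise \<open>e4\<close> would be a zero in the
  radical.\<close>

lemma (in nondegenerate_quadratic) normal_form:
  obtains a x y z s t where "a \<noteq> 0"
    "functional x" "functional y" "functional z" "functional s" "functional t"
    "bij (\<lambda>v. ((x v, y v, z v), (s v, t v)))"
    "\<And>v. Q v = x v * y v + a * (z v)^2 + s v * t v"
proof -
  let ?q = "CARD('a)"
  have q: "2 \<le> ?q" by (rule two_le_card_field)
  obtain e0 where e0: "e0 \<noteq> 0" "Q e0 = 0"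
    using ex_zero by blast
  obtain e1 where e1: "Q e1 = 0" "polar Q e0 e1 = 1"
    using nonsingular[OF e0(2,1)] hyperbolic_partner[OF vec.subspace_UNIV UNIV_I e0(2)] by blast
  let ?W = "perp Q e1 (perp Q e0 UNIV)"
  have W: "vec.subspace ?W"
    by (intro subspace_perp) auto
  have "?q * ?q ^ 4 \<le> ?q * card (perp Q e0 UNIV)"
    using card_perp_ge[OF vec.subspace_UNIV, of e0] card_V by (simp only: power_Suc[symmetric]) simp
  then have "?q ^ 4 \<le> card (perp Q e0 UNIV)"
    by simp
  then have "?q * ?q ^ 3 \<le> card (perp Q e0 UNIV)"
    by (simp flip: power_Suc)
  then have "?q * ?q ^ 3 \<le> ?q * card ?W"
    using card_perp_ge[OF subspace_perp[OF vec.subspace_UNIV]] by (rule le_trans)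
  then have cW: "?q ^ 3 \<le> card ?W"
    by simp
  then obtain e2 where e2: "e2 \<in> ?W" "e2 \<noteq> 0" "Q e2 = 0"
    using ex_nontrivial_zero[OF W] by blast
  have o2: "polar Q e0 e2 = 0" "polar Q e1 e2 = 0"
    using e2 by (auto simp: perp_def)
  obtain w where w: "polar Q e2 w \<noteq> 0"
    using nonsingular[OF e2(3,2)] by blast
  \<comment> \<open>The projection of \<open>w\<close> to \<open>?W\<close>; its pairing with
    \<open>e2\<close> is unchanged because \<open>e2\<close> is orthogonal to \<open>e0\<close> and
    \<open>e1\<close>.\<close>
  have "w - polar Q e1 w *s e0 - polar Q e0 w *s e1 \<in> ?W"
    using e0 e1 by (simp add: perp_def polar_linear polar_self polar_commute[of e1 e0])
  moreover have "polar Q e2 (w - polar Q e1 w *s e0 - polar Q e0 w *s e1) \<noteq> 0"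
    using w o2 by (simp add: polar_linear polar_commute[of e2])
  ultimately obtain e3 where e3: "e3 \<in> ?W" "Q e3 = 0" "polar Q e2 e3 = 1"
    using hyperbolic_partner[OF W e2(1,3)] by blast
  have o3: "polar Q e0 e3 = 0" "polar Q e1 e3 = 0"
    using e3 by (auto simp: perp_def)
  let ?X = "perp Q e3 (perp Q e2 ?W)"
  have "?q * ?q ^ 2 \<le> ?q * card (perp Q e2 ?W)"
    using le_trans[OF cW card_perp_ge[OF W, of e2]] by (simp only: power_Suc[symmetric]) simp
  then have "?q * ?q \<le> card (perp Q e2 ?W)"
    by (simp add: power2_eq_square)
  then have "?q * ?q \<le> ?q * card ?X"
    using card_perp_ge[OF subspace_perp[OF W]] by (rule le_trans)
  then have "1 < card ?X"
    using q by simp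
  then obtain e4 where e4: "e4 \<in> ?X" "e4 \<noteq> 0"
    using ex_nonzero by blast
  have o4: "polar Q e0 e4 = 0" "polar Q e1 e4 = 0" "polar Q e2 e4 = 0" "polar Q e3 e4 = 0"
    using e4 by (auto simp: perp_def)
  note polars = o2 o3 o4 e1(2) e3(3) o2[unfolded polar_commute[of _ e2]]
    o3[unfolded polar_commute[of _ e3]] o4[unfolded polar_commute[of _ e4]]
    e1(2)[unfolded polar_commute[of _ e1]] e3(3)[unfolded polar_commute[of _ e3]]
    polar_self e0(2) e1(1) e2(3) e3(2)
  define \<phi> where "\<phi> = (\<lambda>((x, y, z), (s, t)). x *s e0 + y *s e1 + s *s e2 + t *s e3 + z *s e4)"
  have coord: "polar Q e1 (\<phi> ((x, y, z), (s, t))) = x" "polar Q e0 (\<phi> ((x, y, z), (s, t))) = y"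
    "polar Q e3 (\<phi> ((x, y, z), (s, t))) = s" "polar Q e2 (\<phi> ((x, y, z), (s, t))) = t"
    for x y z s t
    by (simp_all add: \<phi>_def polar_linear polars)
  have inj: "inj \<phi>"
  proof (rule injI)
    fix p r assume eq: "\<phi> p = \<phi> r"
    obtain x y z s t where p: "p = ((x, y, z), (s, t))"
      by (metis prod.exhaust)
    obtain x' y' z' s' t' where r: "r = ((x', y', z'), (s', t'))"
      by (metis prod.exhaust)
    have c: "x = x'" "y = y'" "s = s'" "t = t'"
      using coord[of x y z s t] coord[of x' y' z' s' t'] eq[unfolded p r] by auto
    then have "z *s e4 = z' *s e4"
      using eq by (simp add: p r \<phi>_def)
    then show "p = r"
      using c e4(2) by (simp add: p r)
  qed
  have "card (range \<phi>) = CARD('a ^ 'n)"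
    using inj card_V by (simp add: card_image eval_nat_numeral)
  then have "range \<phi> = UNIV"
    by (intro card_subset_eq) auto
  then have bij: "bij \<phi>"
    using inj by (simp add: bij_def)
  define x y s t where "x = polar Q e1" and "y = polar Q e0" and "s = polar Q e3" and "t = polar Q e2"
  \<comment> \<open>The other coordinates are pairings with the partner vectors. Pairing with
    \<open>e4\<close> would not give \<open>z\<close>, as \<open>polar Q e4 e4 = 2 * Q e4\<close>
    vanishes in characteristic 2; hence the inverse of the coordinate map.\<close>
  define z where "z v = snd (snd (fst (inv \<phi> v)))" for v
  have inv: "inv \<phi> v = ((x v, y v, z v), (s v, t v))" for v
  proof -
    obtain x' y' z' s' t' where i: "inv \<phi> v = ((x', y', z'), (s', t'))"
      by (metis prod.exhaust)
    have "\<phi> ((x', y', z'), (s', t')) = v"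
      using bij unfolding i[symmetric] by (simp add: bij_is_surj surj_f_inv_f)
    then show ?thesis
      using coord[of x' y' z' s' t'] i by (simp add: x_def y_def s_def t_def z_def)
  qed
  have dec: "v = x v *s e0 + y v *s e1 + s v *s e2 + t v *s e3 + z v *s e4" for v
  proof -
    have "v = \<phi> (inv \<phi> v)"
      using bij by (simp add: bij_is_surj surj_f_inv_f)
    then show ?thesis
      unfolding inv by (simp add: \<phi>_def)
  qed
  have fxy: "functional x" "functional y" "functional s" "functional t"
    unfolding x_def y_def s_def t_def by (intro functional_polar)+
  have zdec: "z v *s e4 = v - x v *s e0 - y v *s e1 - s v *s e2 - t v *s e3" for v
    using dec[of v] by (simp add: algebra_simps)
  have fz: "functional z"
    unfolding functional_def
  proof (intro conjI allI)
    fix u v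
    have "z (u + v) *s e4 = z u *s e4 + z v *s e4"
      using fxy by (simp add: zdec functionalD algebra_simps)
    then have "z (u + v) *s e4 = (z u + z v) *s e4"
      by (simp add: vec.scale_left_distrib)
    then show "z (u + v) = z u + z v"
      using e4(2) by (metis vec.scale_cancel_right)
  next
    fix c v
    have "z (c *s v) *s e4 = c *s (z v *s e4)"
      unfolding zdec using fxy by (simp add: functionalD vec.scale_right_diff_distrib)
    then have "z (c *s v) *s e4 = (c * z v) *s e4"
      by simp
    then show "z (c *s v) = c * z v"
      using e4(2) by (metis vec.scale_cancel_right)
  qed
  have "Q v = x v * y v + Q e4 * (z v)^2 + s v * t v" for v
    by (subst dec) (simp add: Q_add Q_scale polar_linear polars algebra_simps)
  moreover have "Q e4 \<noteq> 0"
  proof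
    assume 0: "Q e4 = 0"
    have "polar Q e4 v = 0" for v
      by (subst dec) (simp add: polar_linear polars 0)
    then show False
      using nonsingular[OF 0 e4(2)] by blast
  qed
  moreover have "bij (\<lambda>v. ((x v, y v, z v), (s v, t v)))"
    using bij_imp_bij_inv[OF bij] by (simp add: inv[symmetric])
  ultimately show thesis
    using that fxy fz by blast
qed

section \<open>Counting the zeros on an extremal pair of hyperplanes\<close>

lemma card_hyperbola:
  "card {(s, t). s * t = (c :: 'a::{field,finite})} =
    (if c = 0 then CARD('a) else 0) + (CARD('a) - 1)"
proof (cases "c = 0")
  case True
  have "{(s, t). s * t = c} = {0 :: 'a} \<times> (UNIV :: 'a set) \<union> (UNIV - {0}) \<times> {0 :: 'a}"
    using True by auto
  moreover have "card ({0 :: 'a} \<times> (UNIV :: 'a set) \<union> (UNIV - {0}) \<times> {0 :: 'a}) =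
      card ({0 :: 'a} \<times> (UNIV :: 'a set)) + card ((UNIV - {0 :: 'a}) \<times> {0 :: 'a})"
    by (intro card_Un_disjoint) auto
  ultimately show ?thesis
    using True by (simp add: card_cartesian_product card_Diff_singleton)
next
  case False
  have "{(s, t). s * t = c} = (\<lambda>s. (s, c / s)) ` (UNIV - {0})"
    using False by (auto simp: image_iff)
  moreover have "card ((\<lambda>s. (s, c / s)) ` (UNIV - {0})) = card (UNIV - {0 :: 'a})"
    by (intro card_image) (auto simp: inj_on_def)
  ultimately show ?thesis
    using False by (simp add: card_Diff_singleton)
qed

text \<open>Over each \<open>r\<close> the equation \<open>s * t = - h r\<close> has q - 1
  solutions, and q further ones when \<open>h r = 0\<close>. This reduces the count to the three
  coordinates other than \<open>s\<close> and \<open>t\<close>.\<close>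

lemma card_split_by_hyperbola:
  fixes h :: "'b \<Rightarrow> 'a::{field,finite}"
  assumes "finite R"
  shows "card {(r, (s, t)). r \<in> R \<and> h r + s * t = 0} =
    (CARD('a) - 1) * card R + CARD('a) * card {r \<in> R. h r = 0}"
proof -
  have "{(r, (s, t)). r \<in> R \<and> h r + s * t = 0} = (SIGMA r:R. {(s, t). s * t = - h r})"
    by (auto simp: add_eq_0_iff)
  then have "card {(r, (s, t)). r \<in> R \<and> h r + s * t = 0} = (\<Sum>r\<in>R. card {(s, t). s * t = - h r})"
    using assms by (simp add: card_SigmaI)
  also have "\<dots> = (\<Sum>r\<in>R. if h r = 0 then CARD('a) else 0) + (CARD('a) - 1) * card R"
    unfolding card_hyperbola sum.distrib by simp
  also have "(\<Sum>r\<in>R. if h r = 0 then CARD('a) else 0) = CARD('a) * card {r \<in> R. h r = 0}"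
    using assms by (simp add: sum.If_cases Int_def)
  finally show ?thesis by simp
qed

text \<open>The conic \<open>x y + a z\<^sup>2 = 0\<close> meets the line \<open>z = 0\<close> in two points and the line through its points
  \<open>(-a, 1, 1)\<close> and \<open>(-a \<mu>\<^sup>2, 1, \<mu>)\<close> in exactly these two.\<close>

lemma card_secant_pair:
  fixes a \<mu> :: "'a::{field,finite}"
  assumes a: "a \<noteq> 0" and \<mu>: "\<mu> \<noteq> 0" "\<mu> \<noteq> 1"
  defines "R \<equiv> {(x, y, z). z * (x + a * (1 + \<mu>) * z - a * \<mu> * y) = 0}"
  shows "card R + CARD('a) = 2 * CARD('a)^2"
    and "card {r \<in> R. (case r of (x, y, z) \<Rightarrow> x * y + a * z^2) = 0} + 3 = 4 * CARD('a)"
proof -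
  let ?q = "CARD('a)"
  let ?A = "(\<lambda>(x, y). (x, y, 0 :: 'a)) ` (UNIV :: ('a \<times> 'a) set)"
  let ?B = "(\<lambda>(y, z). (a * \<mu> * y - a * (1 + \<mu>) * z, y, z)) ` (UNIV :: ('a \<times> 'a) set)"
  let ?C = "range (\<lambda>y. (a * \<mu> * y, y, 0 :: 'a))"
  have line: "x + a * (1 + \<mu>) * z - a * \<mu> * y = 0 \<longleftrightarrow> x = a * \<mu> * y - a * (1 + \<mu>) * z" for x y z
    by (simp add: diff_eq_eq eq_diff_eq)
  have "R = ?A \<union> ?B"
    unfolding R_def mult_eq_0_iff line by (auto simp: image_iff)
  moreover have "?A \<inter> ?B = ?C"
    by (auto simp: image_iff)
  moreover have "card ?A = ?q^2" "card ?B = ?q^2" "card ?C = ?q"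
    by (subst card_image; auto simp: inj_on_def power2_eq_square)+
  ultimately show "card R + ?q = 2 * ?q^2"
    using card_Un_Int[of ?A ?B] by simp
  \<comment> \<open>\<open>?D\<close> consists of the multiples of the two conic points with z = 0,
    including the zero vector; \<open>?E\<close> of the nonzero multiples of the conic points with
    parameters 1 and \<open>\<mu>\<close>.\<close>
  let ?D = "(\<lambda>(x, y). (x, y, 0 :: 'a)) ` {(x :: 'a, y). x * y = 0}"
  let ?E = "(\<lambda>(l, y). (- a * l^2 * y, y, l * y)) ` ({1, \<mu>} \<times> (UNIV - {0}))"
  have "{r \<in> R. (case r of (x, y, z) \<Rightarrow> x * y + a * z^2) = 0} = ?D \<union> ?E"
  proof
    show "?D \<union> ?E \<subseteq> {r \<in> R. (case r of (x, y, z) \<Rightarrow> x * y + a * z^2) = 0}"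
      by (auto simp: R_def power2_eq_square algebra_simps)
    show "{r \<in> R. (case r of (x, y, z) \<Rightarrow> x * y + a * z^2) = 0} \<subseteq> ?D \<union> ?E"
    proof clarify
      fix x y z assume R: "(x, y, z) \<in> R" and conic: "x * y + a * z^2 = 0" and nE: "(x, y, z) \<notin> ?E"
      show "(x, y, z) \<in> ?D"
      proof (cases "z = 0")
        case False
        then have y: "y \<noteq> 0"
          using conic a by auto
        have "x + a * (1 + \<mu>) * z - a * \<mu> * y = 0"
          using R False by (simp add: R_def)
        then have x: "x = a * \<mu> * y - a * (1 + \<mu>) * z"
          unfolding line .
        \<comment> \<open>The plane was chosen so that, after substituting for \<open>x\<close>, the
          conic equation factors with exactly the roots \<open>z = y\<close> and
          \<open>z = \<mu> * y\<close>.\<close>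
        have "a * ((z - y) * (z - \<mu> * y)) = 0"
          using conic unfolding x by (simp add: algebra_simps power2_eq_square)
        then consider "z = y" | "z = \<mu> * y"
          using a by auto
        then have "(x, y, z) \<in> ?E"
        proof cases
          case 1
          then have "(x, y, z) = (\<lambda>(l, y). (- a * l^2 * y, y, l * y)) (1, y)"
            by (simp add: x algebra_simps)
          then show ?thesis
            using y by blast
        next
          case 2
          then have "(x, y, z) = (\<lambda>(l, y). (- a * l^2 * y, y, l * y)) (\<mu>, y)"
            by (simp add: x algebra_simps power2_eq_square)
          then show ?thesis
            using y by blast
        qed
        then show ?thesis
          using nE by blast
      qed (use conic in \<open>auto simp: image_iff\<close>)
    qed
  qed
  moreover have "?D \<inter> ?E = {}"
    using \<mu> by auto
  moreover have "card ?D = ?q + (?q - 1)"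
    using card_hyperbola[of "0 :: 'a"] by (subst card_image) (auto simp: inj_on_def)
  moreover have "card ?E = 2 * (?q - 1)"
    using \<mu> by (subst card_image) (auto simp: inj_on_def card_cartesian_product card_Diff_singleton)
  moreover have "2 \<le> ?q"
    by (rule two_le_card_field)
  ultimately show "card {r \<in> R. (case r of (x, y, z) \<Rightarrow> x * y + a * z^2) = 0} + 3 = 4 * ?q"
    by (simp add: card_Un_disjoint)
qed

text \<open>A scalar \<open>\<mu>\<close> other than 0 and 1 gives a secant through two conic points
  off the line \<open>z = 0\<close>. With 2q^2 - q vectors in the two planes and 4q - 3 of them on
  the conic, the fibre count is (q - 1)(2q^2 - q) + q(4q - 3).\<close>

lemma (in nondegenerate_quadratic) ex_secant_pair:
  assumes q: "CARD('a) \<noteq> 2"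
  obtains l m where "functional l" "functional m"
    "card {v. Q v = 0 \<and> l v * m v = 0} + 2 * CARD('a) = 2 * CARD('a)^3 + CARD('a)^2"
proof -
  let ?q = "CARD('a)"
  have "{0, 1 :: 'a} \<noteq> UNIV"
  proof
    assume *: "{0, 1 :: 'a} = UNIV"
    have "?q = card {0, 1 :: 'a}"
      unfolding * ..
    then show False
      using q by simp
  qed
  then obtain \<mu> :: 'a where \<mu>: "\<mu> \<noteq> 0" "\<mu> \<noteq> 1"
    by blast
  obtain a x y z s t where a: "a \<noteq> 0"
    and func: "functional x" "functional y" "functional z" "functional s" "functional t"
    and bij: "bij (\<lambda>v. ((x v, y v, z v), (s v, t v)))"
    and Q: "\<And>v. Q v = x v * y v + a * (z v)^2 + s v * t v"
    by (rule normal_form, rule that, assumption+)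
  let ?m = "\<lambda>v. x v + (a * (1 + \<mu>)) * z v - (a * \<mu>) * y v"
  let ?g = "\<lambda>v. ((x v, y v, z v), (s v, t v))"
  let ?h = "\<lambda>(x, y, z). x * y + a * z^2"
  define R where "R = {(x, y, z). z * (x + a * (1 + \<mu>) * z - a * \<mu> * y) = 0}"
  have "{v. Q v = 0 \<and> z v * ?m v = 0} = ?g -` {(r, (s, t)). r \<in> R \<and> ?h r + s * t = 0}"
    by (auto simp: R_def Q)
  moreover have "card (?g -` {(r, (s, t)). r \<in> R \<and> ?h r + s * t = 0}) =
      card {(r, (s, t)). r \<in> R \<and> ?h r + s * t = 0}"
    using bij_is_surj[OF bij] by (intro card_vimage_inj[OF bij_is_inj[OF bij]]) simp
  ultimately have "card {v. Q v = 0 \<and> z v * ?m v = 0} =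
      card {(r, (s, t)). r \<in> R \<and> ?h r + s * t = 0}"
    by (simp only:)
  also have "\<dots> = (?q - 1) * card R + ?q * card {r \<in> R. ?h r = 0}"
    by (rule card_split_by_hyperbola) simp
  finally have c: "card {v. Q v = 0 \<and> z v * ?m v = 0} =
    (?q - 1) * card R + ?q * card {r \<in> R. ?h r = 0}" .
  have R: "card R + ?q = 2 * ?q^2" "card {r \<in> R. ?h r = 0} + 3 = 4 * ?q"
    unfolding R_def by (rule card_secant_pair[OF a \<mu>])+
  obtain k where k: "?q = Suc k"
    using two_le_card_field[where 'a = 'a] by (cases ?q) auto
  have "card R = (2 * k + 1) * ?q"
    using R(1) unfolding k by (simp add: power2_eq_square)
  moreover have "card {r \<in> R. ?h r = 0} = 4 * k + 1"
    using R(2) unfolding k by simp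
  ultimately have "card {v. Q v = 0 \<and> z v * ?m v = 0} + 2 * ?q = 2 * ?q^3 + ?q^2"
    unfolding c k by (simp add: power2_eq_square power3_eq_cube algebra_simps)
  then show thesis
    using func by (intro that[of z ?m] functional_add functional_diff functional_scale)
qed

section \<open>Forms of degree 2 as quadratic maps\<close>

definition monom_eval :: "('n::finite \<Rightarrow>\<^sub>0 nat) \<Rightarrow> 'a::comm_ring_1 ^ 'n \<Rightarrow> 'a" where
  "monom_eval m v = (\<Prod>i\<in>UNIV. (v $ i) ^ Poly_Mapping.lookup m i)"

definition monom_deg :: "('n::finite \<Rightarrow>\<^sub>0 nat) \<Rightarrow> nat" where
  "monom_deg m = (\<Sum>i\<in>UNIV. Poly_Mapping.lookup m i)"

lemma monom_eval_add: "monom_eval (m + n) v = monom_eval m v * monom_eval n v"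
  by (simp add: monom_eval_def lookup_add power_add prod.distrib)

lemma monom_eval_0: "monom_eval 0 v = 1"
  by (simp add: monom_eval_def)

lemma monom_eval_single: "monom_eval (Poly_Mapping.single i 1) v = v $ i"
proof -
  have "monom_eval (Poly_Mapping.single i 1) v = (\<Prod>j\<in>UNIV. if j = i then v $ j else 1)"
    unfolding monom_eval_def by (intro prod.cong) (auto simp: lookup_single)
  then show ?thesis by simp
qed

lemma monom_deg_add: "monom_deg (m + n) = monom_deg m + monom_deg n"
  by (simp add: monom_deg_def lookup_add sum.distrib)

lemma monom_deg_single: "monom_deg (Poly_Mapping.single i k) = k"
proof -
  have "monom_deg (Poly_Mapping.single i k) = (\<Sum>j\<in>UNIV. if j = i then k else 0)"
    unfolding monom_deg_def by (intro sum.cong) (auto simp: lookup_single)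
  then show ?thesis by simp
qed

section \<open>Evaluation respects sums and products of polynomials\<close>

lemma poly_eval_superset:
  assumes "finite S" "Poly_Mapping.keys f \<subseteq> S"
  shows "poly_eval f v = (\<Sum>m\<in>S. Poly_Mapping.lookup f m * monom_eval m v)"
  unfolding poly_eval_def monom_eval_def using assms
  by (intro sum.mono_neutral_left) (auto simp: in_keys_iff)

lemma poly_eval_keys:
  "poly_eval f v = (\<Sum>m\<in>Poly_Mapping.keys f. Poly_Mapping.lookup f m * monom_eval m v)"
  by (rule poly_eval_superset) auto

lemma poly_eval_0: "poly_eval 0 v = 0"
  by (simp add: poly_eval_def)

lemma poly_eval_add: "poly_eval (f + g) v = poly_eval f v + poly_eval g v"
proof -
  let ?S = "Poly_Mapping.keys f \<union> Poly_Mapping.keys g"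
  have "Poly_Mapping.keys (f + g) \<subseteq> ?S"
    by (rule keys_add)
  then show ?thesis
    using poly_eval_superset[of ?S "f + g" v] poly_eval_superset[of ?S f v]
      poly_eval_superset[of ?S g v]
    by (simp add: lookup_add algebra_simps sum.distrib)
qed

lemma poly_eval_sum: "poly_eval (\<Sum>i\<in>I. f i) v = (\<Sum>i\<in>I. poly_eval (f i) v)"
  by (induction I rule: infinite_finite_induct) (simp_all add: poly_eval_0 poly_eval_add)

lemma poly_eval_single: "poly_eval (Poly_Mapping.single m c) v = c * monom_eval m v"
  by (subst poly_eval_superset[of "{m}"]) auto

lemma poly_mapping_decomp:
  "f = (\<Sum>m\<in>Poly_Mapping.keys f. Poly_Mapping.single m (Poly_Mapping.lookup f m))"
proof (rule poly_mapping_eqI)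
  fix k
  have "Poly_Mapping.lookup (\<Sum>m\<in>Poly_Mapping.keys f. Poly_Mapping.single m (Poly_Mapping.lookup f m)) k
    = (\<Sum>m\<in>Poly_Mapping.keys f. if m = k then Poly_Mapping.lookup f m else 0)"
    unfolding lookup_sum by (intro sum.cong) (auto simp: lookup_single)
  also have "\<dots> = Poly_Mapping.lookup f k"
    by (simp add: in_keys_iff)
  finally show "Poly_Mapping.lookup f k =
    Poly_Mapping.lookup (\<Sum>m\<in>Poly_Mapping.keys f. Poly_Mapping.single m (Poly_Mapping.lookup f m)) k" ..
qed

lemma poly_eval_mult: "poly_eval (f * g) v = poly_eval f v * poly_eval g v"
proof -
  let ?f = "\<lambda>m. Poly_Mapping.single m (Poly_Mapping.lookup f m)"
  let ?g = "\<lambda>m. Poly_Mapping.single m (Poly_Mapping.lookup g m)"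
  have "f * g = (\<Sum>m\<in>Poly_Mapping.keys f. ?f m) * (\<Sum>n\<in>Poly_Mapping.keys g. ?g n)"
    using poly_mapping_decomp[of f] poly_mapping_decomp[of g] by metis
  also have "\<dots> = (\<Sum>m\<in>Poly_Mapping.keys f. \<Sum>n\<in>Poly_Mapping.keys g.
      Poly_Mapping.single (m + n) (Poly_Mapping.lookup f m * Poly_Mapping.lookup g n))"
    by (simp add: sum_product mult_single)
  finally show ?thesis
    unfolding poly_eval_keys[of f] poly_eval_keys[of g] sum_product
    by (simp add: poly_eval_sum poly_eval_single monom_eval_add mult_ac)
qed

lemma poly_eval_const: "poly_eval (const_poly c) v = c"
  by (simp add: const_poly_def poly_eval_single monom_eval_0)

lemma poly_eval_var: "poly_eval (var_poly i) v = v $ i"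
  by (simp only: var_poly_def poly_eval_single monom_eval_single mult_1)

lemma poly_eval_1: "poly_eval 1 v = 1"
  using poly_eval_const[of 1 v] by (simp add: const_poly_def)

lemma poly_eval_power: "poly_eval (f ^ n) v = poly_eval f v ^ n"
  by (induction n) (simp_all add: poly_eval_1 poly_eval_mult)

lemma poly_eval_prod: "poly_eval (\<Prod>i\<in>I. f i) v = (\<Prod>i\<in>I. poly_eval (f i) v)"
  by (induction I rule: infinite_finite_induct) (simp_all add: poly_eval_1 poly_eval_mult)

lemma poly_eval_lin_subst: "poly_eval (lin_subst A f) v = poly_eval f (A *v v)"
  unfolding lin_subst_def poly_eval_sum poly_eval_mult poly_eval_prod poly_eval_power
    poly_eval_const poly_eval_var
  by (simp add: poly_eval_def matrix_vector_mult_def)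

section \<open>Homogeneous polynomials and linear substitution\<close>

definition homogeneous :: "nat \<Rightarrow> ('n::finite, 'a::comm_ring_1) mpoly \<Rightarrow> bool" where
  "homogeneous d f \<longleftrightarrow> (\<forall>m\<in>Poly_Mapping.keys f. monom_deg m = d)"

lemma forms2_iff_homogeneous: "f \<in> forms2 \<longleftrightarrow> homogeneous 2 f"
  by (simp add: forms2_def homogeneous_def monom_deg_def)

lemma homogeneous_single: "monom_deg m = d \<Longrightarrow> homogeneous d (Poly_Mapping.single m c)"
  by (simp add: homogeneous_def)

lemma homogeneous_add: "homogeneous d f \<Longrightarrow> homogeneous d g \<Longrightarrow> homogeneous d (f + g)"
  using keys_add[of f g] by (auto simp: homogeneous_def)

lemma homogeneous_sum: "(\<And>i. i \<in> I \<Longrightarrow> homogeneous d (f i)) \<Longrightarrow> homogeneous d (\<Sum>i\<in>I. f i)"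
  by (induction I rule: infinite_finite_induct)
    (auto simp: homogeneous_add, simp_all add: homogeneous_def)

lemma homogeneous_mult: "homogeneous d f \<Longrightarrow> homogeneous e g \<Longrightarrow> homogeneous (d + e) (f * g)"
  using keys_mult[of f g] by (auto simp: homogeneous_def monom_deg_add)

lemma homogeneous_const: "homogeneous 0 (const_poly c)"
  unfolding const_poly_def by (rule homogeneous_single) (simp add: monom_deg_def)

lemma homogeneous_var: "homogeneous 1 (var_poly i)"
  unfolding var_poly_def by (intro homogeneous_single monom_deg_single)

lemma homogeneous_1: "homogeneous 0 1"
  using homogeneous_const[of 1] by (simp add: const_poly_def)

lemma homogeneous_power: "homogeneous d f \<Longrightarrow> homogeneous (n * d) (f ^ n)"
  by (induction n) (simp_all add: homogeneous_1 homogeneous_mult)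

lemma homogeneous_prod:
  "finite I \<Longrightarrow> (\<And>i. i \<in> I \<Longrightarrow> homogeneous (d i) (f i)) \<Longrightarrow> homogeneous (\<Sum>i\<in>I. d i) (\<Prod>i\<in>I. f i)"
  by (induction I rule: finite_induct) (simp_all add: homogeneous_1 homogeneous_mult)

lemma homogeneous_const_mult: "homogeneous d f \<Longrightarrow> homogeneous d (const_poly c * f)"
  using homogeneous_mult[OF homogeneous_const] by force

lemma homogeneous_linear: "homogeneous 1 (\<Sum>j\<in>UNIV. const_poly (a j) * var_poly j)"
  by (intro homogeneous_sum homogeneous_const_mult homogeneous_var)

lemma lin_subst_forms2:
  assumes "f \<in> forms2"
  shows "lin_subst A f \<in> forms2"
  unfolding forms2_iff_homogeneous lin_subst_def
proof (intro homogeneous_sum homogeneous_const_mult)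
  fix m assume "m \<in> Poly_Mapping.keys f"
  then have "(\<Sum>i\<in>UNIV. Poly_Mapping.lookup m i * 1) = 2"
    using assms by (simp add: forms2_def)
  moreover have "homogeneous (\<Sum>i\<in>UNIV. Poly_Mapping.lookup m i * 1)
      (\<Prod>i\<in>UNIV. (\<Sum>j\<in>UNIV. const_poly (A $ i $ j) * var_poly j) ^ Poly_Mapping.lookup m i)"
    by (intro homogeneous_prod homogeneous_power homogeneous_linear) simp
  ultimately show "homogeneous 2
      (\<Prod>i\<in>UNIV. (\<Sum>j\<in>UNIV. const_poly (A $ i $ j) * var_poly j) ^ Poly_Mapping.lookup m i)"
    by simp
qed

section \<open>Monomials of degree 2 and recovery of coefficients from values\<close>

definition pair_monom :: "'n \<Rightarrow> 'n \<Rightarrow> ('n \<Rightarrow>\<^sub>0 nat)" where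
  "pair_monom i j = Poly_Mapping.single i 1 + Poly_Mapping.single j 1"

lemma lookup_pair_monom:
  "Poly_Mapping.lookup (pair_monom i j) k = (if k = i then 1 else 0) + (if k = j then 1 else 0)"
  by (auto simp: pair_monom_def lookup_add lookup_single)

lemma pair_monom_eq_iff:
  "pair_monom k l = pair_monom i j \<longleftrightarrow> (k = i \<and> l = j) \<or> (k = j \<and> l = i)"
proof
  assume "pair_monom k l = pair_monom i j"
  then have eq: "Poly_Mapping.lookup (pair_monom k l) x = Poly_Mapping.lookup (pair_monom i j) x" for x
    by simp
  show "(k = i \<and> l = j) \<or> (k = j \<and> l = i)"
  proof (cases "k = i")
    case True
    then show ?thesis
      using eq[of j] eq[of l] by (cases "l = j") (simp_all add: lookup_pair_monom)
  next
    case False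
    then have "k = j"
      using eq[of k] by (cases "k = j") (simp_all add: lookup_pair_monom)
    then show ?thesis
      using eq[of i] False by (cases "l = i") (simp_all add: lookup_pair_monom)
  qed
qed (auto simp: pair_monom_def add.commute)

lemma monom_eval_pair: "monom_eval (pair_monom i j) v = v $ i * v $ j"
  by (simp only: pair_monom_def monom_eval_add monom_eval_single)

lemma monom_deg_pair: "monom_deg (pair_monom i j) = 2"
  by (simp add: pair_monom_def monom_deg_add monom_deg_single)

lemma monom_deg_2E:
  assumes "monom_deg m = 2"
  obtains i j where "m = pair_monom i j"
proof -
  have "\<exists>i. Poly_Mapping.lookup m i \<noteq> 0"
  proof (rule ccontr)
    assume "\<not> ?thesis"
    then show False
      using assms by (simp add: monom_deg_def)
  qed
  then obtain i where i: "Poly_Mapping.lookup m i \<noteq> 0"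
    by blast
  define m' where "m' = m - Poly_Mapping.single i 1"
  have m: "m = Poly_Mapping.single i 1 + m'"
    by (rule poly_mapping_eqI) (use i in \<open>auto simp: m'_def lookup_add lookup_minus lookup_single when_def\<close>)
  then have "monom_deg m' = 1"
    using assms by (simp add: monom_deg_add monom_deg_single)
  then obtain j where j: "Poly_Mapping.lookup m' j = 1" "\<And>k. k \<noteq> j \<Longrightarrow> Poly_Mapping.lookup m' k = 0"
    unfolding monom_deg_def by (subst (asm) sum_eq_1_iff) auto
  have "m' = Poly_Mapping.single j 1"
    by (rule poly_mapping_eqI) (use j in \<open>auto simp: lookup_single when_def\<close>)
  then show thesis
    using that m by (simp add: pair_monom_def)
qed

lemma forms2_keyE:
  assumes "f \<in> forms2" "m \<in> Poly_Mapping.keys f"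
  obtains i j where "m = pair_monom i j"
proof -
  have "monom_deg m = 2"
    using assms by (auto simp: forms2_iff_homogeneous homogeneous_def)
  then show thesis
    by (rule monom_deg_2E) (rule that)
qed

lemma functional_nth: "functional (\<lambda>v. v $ i)"
  by (simp add: functional_def)

text \<open>Each monomial is a product of two coordinate functionals. The induction runs over
  subsets of the support, with the coefficients of \<open>f\<close> fixed.\<close>

lemma quadratic_poly_eval:
  fixes f :: "('n::finite, 'a::field) mpoly"
  assumes f: "f \<in> forms2"
  shows "quadratic (poly_eval f)"
proof -
  have "quadratic (\<lambda>v :: 'a ^ 'n. \<Sum>m\<in>K. Poly_Mapping.lookup f m * monom_eval m v)"
    if "finite K" "K \<subseteq> Poly_Mapping.keys f" for K
    using that
  proof (induction K rule: finite_induct)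
    case empty
    show ?case
      by unfold_locales (simp_all add: polar_def functional_def)
  next
    case (insert m K)
    obtain i j where "m = pair_monom i j"
      using forms2_keyE[OF f, of m] insert by auto
    then have "quadratic (\<lambda>v :: 'a ^ 'n. monom_eval m v)"
      by (simp add: monom_eval_pair quadratic_product functional_nth)
    moreover have "quadratic (\<lambda>v :: 'a ^ 'n. \<Sum>m\<in>K. Poly_Mapping.lookup f m * monom_eval m v)"
      using insert by simp
    ultimately have "quadratic (\<lambda>v :: 'a ^ 'n. (\<Sum>m\<in>K. Poly_Mapping.lookup f m * monom_eval m v) +
        Poly_Mapping.lookup f m * monom_eval m v)"
      by (intro quadratic_pencil)
    then show ?case
      using insert by (simp add: add.commute)
  qed
  then show ?thesis
    unfolding poly_eval_keys[abs_def] by simp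
qed

lemma poly_eval_axis:
  assumes f: "f \<in> forms2"
  shows "poly_eval f (axis i 1) = Poly_Mapping.lookup f (pair_monom i i)"
proof -
  have "poly_eval f (axis i 1) =
    (\<Sum>m\<in>Poly_Mapping.keys f. if m = pair_monom i i then Poly_Mapping.lookup f m else 0)"
    unfolding poly_eval_keys
  proof (intro sum.cong refl)
    fix m assume "m \<in> Poly_Mapping.keys f"
    then obtain k l where "m = pair_monom k l"
      using forms2_keyE[OF f] by blast
    then show "Poly_Mapping.lookup f m * monom_eval m (axis i 1) =
        (if m = pair_monom i i then Poly_Mapping.lookup f m else 0)"
      by (auto simp: monom_eval_pair pair_monom_eq_iff axis_def)
  qed
  then show ?thesis
    by (simp add: in_keys_iff)
qed

lemma polar_poly_eval_axis:
  assumes f: "f \<in> forms2" and ij: "i \<noteq> j"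
  shows "polar (poly_eval f) (axis i 1) (axis j 1) = Poly_Mapping.lookup f (pair_monom i j)"
proof -
  have "polar (poly_eval f) (axis i 1) (axis j 1) =
    (\<Sum>m\<in>Poly_Mapping.keys f. Poly_Mapping.lookup f m * polar (monom_eval m) (axis i 1) (axis j 1))"
    unfolding polar_def poly_eval_keys by (simp add: sum_subtractf sum.distrib algebra_simps)
  also have "\<dots> =
    (\<Sum>m\<in>Poly_Mapping.keys f. if m = pair_monom i j then Poly_Mapping.lookup f m else 0)"
  proof (intro sum.cong refl)
    fix m assume "m \<in> Poly_Mapping.keys f"
    then obtain k l where "m = pair_monom k l"
      using forms2_keyE[OF f] by blast
    then show "Poly_Mapping.lookup f m * polar (monom_eval m) (axis i 1) (axis j 1) =
        (if m = pair_monom i j then Poly_Mapping.lookup f m else 0)"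
      using ij by (auto simp: polar_def monom_eval_pair pair_monom_eq_iff axis_def)
  qed
  finally show ?thesis
    by (simp add: in_keys_iff)
qed

text \<open>Polynomials over a finite field are not determined by their values in general, but forms
  of degree 2 are: values at unit vectors give the coefficients of squares, and the polar form at
  pairs of unit vectors gives the mixed ones.\<close>

lemma forms2_eqI:
  assumes f: "f \<in> forms2" and g: "g \<in> forms2" and eq: "\<And>v. poly_eval f v = poly_eval g v"
  shows "f = g"
proof (rule poly_mapping_eqI)
  fix m
  show "Poly_Mapping.lookup f m = Poly_Mapping.lookup g m"
  proof (cases "monom_deg m = 2")
    case True
    then obtain i j where m: "m = pair_monom i j"
      by (rule monom_deg_2E)
    have "poly_eval f = poly_eval g"
      using eq by blast
    then show ?thesis
      unfolding m using poly_eval_axis[OF f, of i] poly_eval_axis[OF g, of i]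
        polar_poly_eval_axis[OF f, of i j] polar_poly_eval_axis[OF g, of i j]
      by (cases "i = j") auto
  next
    case False
    then have "m \<notin> Poly_Mapping.keys f" "m \<notin> Poly_Mapping.keys g"
      using f g by (auto simp: forms2_iff_homogeneous homogeneous_def)
    then show ?thesis
      by (simp add: in_keys_iff)
  qed
qed

section \<open>Full rank and nonsingularity\<close>

lemma invertible_with_column:
  fixes v :: "'a::field ^ 'n::finite"
  assumes "v \<noteq> 0"
  obtains A :: "'a ^ 'n ^ 'n" and k where "invertible A" "A *v axis k 1 = v"
proof -
  obtain k where k: "v $ k \<noteq> 0"
    using assms by (auto simp: vec_eq_iff)
  \<comment> \<open>The identity matrix with column \<open>k\<close> replaced by \<open>v\<close>;
    it is invertible because \<open>v $ k \<noteq> 0\<close>.\<close>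
  define A :: "'a ^ 'n ^ 'n" where "A = (\<chi> i j. if j = k then v $ i else if i = j then 1 else 0)"
  have A: "(A *v x) $ i = v $ i * x $ k + (if i = k then 0 else x $ i)" for x i
  proof -
    have "(A *v x) $ i = (\<Sum>j\<in>UNIV. (if j = k then v $ i * x $ j else 0) +
        (if j = i then (if i = k then 0 else x $ j) else 0))"
      unfolding matrix_vector_mult_def A_def by (auto intro!: sum.cong)
    then show ?thesis
      by (simp add: sum.distrib)
  qed
  have "x = 0" if "A *v x = 0" for x
  proof -
    have *: "v $ i * x $ k + (if i = k then 0 else x $ i) = 0" for i
      using that A[of x i] by simp
    have "x $ k = 0"
      using *[of k] k by simp
    then have "x $ i = 0" for i
      using *[of i] by (cases "i = k") auto
    then show ?thesis
      by (simp add: vec_eq_iff)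
  qed
  then have "invertible A"
    by (simp add: invertible_left_inverse matrix_left_invertible_ker)
  moreover have "A *v axis k 1 = v"
    by (simp add: vec_eq_iff A axis_def)
  ultimately show thesis
    by (rule that)
qed

text \<open>Suppose \<open>v\<close> is a zero in the radical. A coordinate change that makes
  \<open>v\<close> the image of a unit vector kills every coefficient involving the corresponding
  indeterminate, so fewer indeterminates suffice than the rank allows.\<close>

lemma full_rank_nonsingular:
  fixes f :: "('n::finite, 'a::field) mpoly"
  assumes f: "f \<in> forms2" and rank: "quadric_rank f = CARD('n)"
    and v: "poly_eval f v = 0" "v \<noteq> 0"
  shows "\<exists>w. polar (poly_eval f) v w \<noteq> 0"
proof (rule ccontr)
  assume no: "\<not> ?thesis"
  obtain A :: "'a ^ 'n ^ 'n" and k where A: "invertible A" "A *v axis k 1 = v"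
    by (rule invertible_with_column[OF v(2)], rule that, assumption+)
  let ?g = "lin_subst A f"
  have g: "?g \<in> forms2"
    by (rule lin_subst_forms2[OF f])
  have coeff: "Poly_Mapping.lookup ?g (pair_monom k j) = 0" for j
  proof (cases "j = k")
    case True
    then show ?thesis
      using poly_eval_axis[OF g, of k] v(1) A(2) by (simp add: poly_eval_lin_subst)
  next
    case False
    have "polar (poly_eval ?g) (axis k 1) (axis j 1) = polar (poly_eval f) v (A *v axis j 1)"
      using A(2) by (simp add: polar_def poly_eval_lin_subst matrix_vector_right_distrib)
    then show ?thesis
      using polar_poly_eval_axis[OF g, of k j] False no by simp
  qed
  have "k \<notin> indets ?g"
  proof
    assume "k \<in> indets ?g"
    then obtain m where m: "m \<in> Poly_Mapping.keys ?g" "Poly_Mapping.lookup m k \<noteq> 0"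
      by (auto simp: indets_def in_keys_iff)
    obtain i j where ij: "m = pair_monom i j"
      using forms2_keyE[OF g m(1)] by blast
    then have "k = i \<or> k = j"
      using m(2) by (simp add: lookup_pair_monom split: if_splits)
    then have "m = pair_monom k j \<or> m = pair_monom k i"
      unfolding ij pair_monom_eq_iff by blast
    then show False
      using coeff m(1) by (auto simp: in_keys_iff)
  qed
  then have "card (indets ?g) < CARD('n)"
    by (intro psubset_card_mono) auto
  moreover have "quadric_rank f \<le> card (indets ?g)"
    unfolding quadric_rank_def using A(1) by (intro Least_le exI[of _ A] conjI refl)
  ultimately show False
    using rank by simp
qed

section \<open>Projective points, forms and codewords\<close>

lemma proj_point_nonzero: "p \<in> proj_points \<Longrightarrow> v \<in> p \<Longrightarrow> v \<noteq> 0"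
  by (elim proj_pointE) auto

lemma proj_point_span:
  fixes v :: "'a::field ^ 'n"
  assumes "v \<noteq> 0"
  shows "{c *s v |c. c \<noteq> 0} \<in> proj_points" and "v \<in> {c *s v |c. c \<noteq> 0}"
proof -
  show "v \<in> {c *s v |c. c \<noteq> 0}"
    by (auto intro!: exI[of _ 1])
  have "{(v, w). \<exists>c. c \<noteq> 0 \<and> w = c *s v} `` {v} \<in> proj_points"
    unfolding proj_points_def using assms by (intro quotientI) simp
  moreover have "{(v, w). \<exists>c. c \<noteq> 0 \<and> w = c *s v} `` {v} = {c *s v |c. c \<noteq> 0}"
    by auto
  ultimately show "{c *s v |c. c \<noteq> 0} \<in> proj_points"
    by simp
qed

lemma proj_point_eq:
  assumes "p \<in> proj_points" "v \<in> p"
  shows "p = {c *s v |c. c \<noteq> 0}"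
proof -
  obtain u where u: "u \<noteq> 0" "p = {c *s u |c. c \<noteq> 0}"
    using assms(1) by (rule proj_pointE)
  then obtain d where d: "d \<noteq> 0" "v = d *s u"
    using assms(2) by blast
  have "c *s u = (c / d) *s v" "c *s v = (c * d) *s u" for c
    using d by simp_all
  then show ?thesis
    unfolding u(2) using d(1) by (auto intro: exI[of _ "_ / d"] exI[of _ "_ * d"])
qed

lemma card_proj_point:
  fixes p :: "('a::{field,finite} ^ 'n::finite) set"
  assumes "p \<in> proj_points"
  shows "card p = CARD('a) - 1"
proof -
  obtain u where u: "u \<noteq> 0" "p = {c *s u |c. c \<noteq> 0}"
    using assms by (rule proj_pointE)
  have "p = (\<lambda>c. c *s u) ` (UNIV - {0})"
    unfolding u(2) by auto
  then have "card p = card (UNIV - {0 :: 'a})"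
    using u(1) by (simp add: card_image inj_on_def)
  then show ?thesis
    by (simp add: card_Diff_singleton)
qed

lemma card_Union_proj_points:
  fixes Z :: "('a::{field,finite} ^ 'n::finite) set set"
  assumes Z: "Z \<subseteq> proj_points"
  shows "(CARD('a) - 1) * card Z = card (\<Union>Z)"
proof (rule card_partition)
  show "card p = CARD('a) - 1" if "p \<in> Z" for p
    using that Z by (intro card_proj_point) auto
  show "p \<inter> r = {}" if pr: "p \<in> Z" "r \<in> Z" "p \<noteq> r" for p r
  proof (rule equals0I)
    fix v assume "v \<in> p \<inter> r"
    then have "p = {c *s v |c. c \<noteq> 0}" "r = {c *s v |c. c \<noteq> 0}"
      using pr(1,2) Z by (auto intro!: proj_point_eq)
    then show False
      using pr(3) by simp
  qed
qed auto

text \<open>Each projective point is a class of q - 1 vectors; the remaining common zero is the zero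
  vector.\<close>

lemma card_common_zero_set:
  fixes f g :: "('n::finite, 'a::{field,finite}) mpoly"
  assumes f: "f \<in> forms2" and g: "g \<in> forms2"
  shows "(CARD('a) - 1) * card (zero_set f \<inter> zero_set g) + 1 =
    card {v. poly_eval f v = 0 \<and> poly_eval g v = 0}"
proof -
  let ?Z = "zero_set f \<inter> zero_set g" and ?V = "{v. poly_eval f v = 0 \<and> poly_eval g v = 0}"
  have zero: "0 \<in> ?V"
    using poly_eval_scale[OF f, of 0 0] poly_eval_scale[OF g, of 0 0] by simp
  have eq: "\<Union>?Z = ?V - {0}"
  proof
    show "\<Union>?Z \<subseteq> ?V - {0}"
      by (auto simp: zero_set_def dest: proj_point_nonzero)
    show "?V - {0} \<subseteq> \<Union>?Z"
    proof
      fix v assume v: "v \<in> ?V - {0}"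
      then have "{c *s v |c. c \<noteq> 0} \<in> ?Z"
        using proj_point_span(1)[of v]
        by (auto simp: zero_set_def poly_eval_scale[OF f] poly_eval_scale[OF g])
      then show "v \<in> \<Union>?Z"
        using proj_point_span(2)[of v] v by blast
    qed
  qed
  have "card (\<Union>?Z) + 1 = card ?V"
    using card_Suc_Diff1[OF finite zero] by (simp only: eq Suc_eq_plus1)
  moreover have "(CARD('a) - 1) * card ?Z = card (\<Union>?Z)"
    by (rule card_Union_proj_points) (auto simp: zero_set_def)
  ultimately show ?thesis by simp
qed

section \<open>Cardinality and dimension; counting forms\<close>

lemma (in vector_space) card_span_independent:
  assumes F: "finite (UNIV :: 'a set)" and "finite B" "independent B"
  shows "card (span B) = CARD('a) ^ card B \<and> finite (span B)"
  using assms(2,3)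
proof (induction B rule: finite_induct)
  case (insert b B)
  have ind: "independent B" "b \<notin> span B"
    using insert by (auto simp: independent_insert split: if_splits)
  have eq: "span (insert b B) = (\<lambda>(k, x). scale k b + x) ` (UNIV \<times> span B)"
  proof
    show "span (insert b B) \<subseteq> (\<lambda>(k, x). scale k b + x) ` (UNIV \<times> span B)"
    proof
      fix x assume "x \<in> span (insert b B)"
      then obtain k where "x - scale k b \<in> span B"
        by (auto simp: span_insert)
      then show "x \<in> (\<lambda>(k, x). scale k b + x) ` (UNIV \<times> span B)"
        by (intro image_eqI[of _ _ "(k, x - scale k b)"]) auto
    qed
    show "(\<lambda>(k, x). scale k b + x) ` (UNIV \<times> span B) \<subseteq> span (insert b B)"
    proof clarify
      fix k x assume "x \<in> span B"
      then have "scale k b + x - scale k b \<in> span B"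
        by simp
      then show "scale k b + x \<in> span (insert b B)"
        unfolding span_insert by blast
    qed
  qed
  have "inj_on (\<lambda>(k, x). scale k b + x) (UNIV \<times> span B)"
  proof (rule inj_onI, clarify)
    fix k x l y assume xy: "x \<in> span B" "y \<in> span B" and eq: "scale k b + x = scale l b + y"
    then have "scale (k - l) b = y - x"
      by (simp add: scale_left_diff_distrib algebra_simps)
    then have "scale (k - l) b \<in> span B"
      using xy span_diff by simp
    then have "k = l"
      using ind(2) span_scale[of "scale (k - l) b" B "inverse (k - l)"] by (cases "k = l") auto
    then show "k = l \<and> x = y"
      using eq by simp
  qed
  then have "card (span (insert b B)) = CARD('a) * card (span B)"
    unfolding eq by (simp add: card_image card_cartesian_product)
  moreover have "finite (span (insert b B))"
    unfolding eq using F insert ind by auto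
  ultimately show ?case
    using insert ind by simp
qed simp

lemma (in vector_space) card_subspace:
  assumes F: "finite (UNIV :: 'a set)" and S: "subspace S" "finite S"
  shows "card S = CARD('a) ^ dim S"
proof -
  obtain B where B: "B \<subseteq> S" "independent B" "S \<subseteq> span B" "card B = dim S"
    by (rule basis_exists)
  have "span B = S"
    using B(1,3) span_minimal[OF B(1) S(1)] by blast
  moreover have "finite B"
    using B(1) S(2) by (rule finite_subset)
  ultimately show ?thesis
    using card_span_independent[OF F _ B(2)] B(4) by simp
qed

text \<open>Unordered pairs correspond to \<open>i \<le> j\<close>. That set and its mirror image
  cover all 25 pairs and share the 5 diagonal ones, so each has 15 elements.\<close>

lemma card_pairs_5: "card (range (\<lambda>(i :: 5, j). pair_monom i j)) = 15"
proof -
  let ?L = "{(i, j :: 5). i \<le> j}"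
  have "range (\<lambda>(i, j). pair_monom i j) = (\<lambda>(i, j). pair_monom i j) ` ?L"
  proof
    show "range (\<lambda>(i, j). pair_monom i j) \<subseteq> (\<lambda>(i, j). pair_monom i j) ` ?L"
    proof clarify
      fix i j :: 5
      have "pair_monom i j = pair_monom j i"
        by (simp add: pair_monom_eq_iff)
      then show "pair_monom i j \<in> (\<lambda>(i, j). pair_monom i j) ` ?L"
        using linear[of i j] by (force simp: image_iff)
    qed
  qed auto
  also have "card \<dots> = card ?L"
    by (intro card_image) (auto simp: inj_on_def pair_monom_eq_iff)
  also have "\<dots> = 15"
  proof -
    let ?G = "{(i, j :: 5). j \<le> i}"
    have "?G = prod.swap ` ?L"
      by (auto simp: image_iff)
    then have "card ?G = card ?L"
      by (simp add: card_image)
    moreover have "?L \<union> ?G = UNIV"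
      by auto
    moreover have "?L \<inter> ?G = range (\<lambda>i. (i, i))"
      by auto
    moreover have "card (range (\<lambda>i :: 5. (i, i))) = 5"
      by (simp add: card_image inj_on_def)
    moreover have "card (UNIV :: (5 \<times> 5) set) = 25"
      by simp
    ultimately show ?thesis
      using card_Un_Int[of ?L ?G] by simp
  qed
  finally show ?thesis .
qed

lemma card_forms2: "card (forms2 :: (5, 'a::{field,finite}) mpoly set) = CARD('a) ^ 15"
proof -
  let ?D = "range (\<lambda>(i :: 5, j). pair_monom i j)"
  have deg: "m \<in> ?D \<longleftrightarrow> monom_deg m = 2" for m
    by (auto simp: monom_deg_pair elim!: monom_deg_2E)
  let ?r = "\<lambda>f :: (5, 'a) mpoly. restrict (Poly_Mapping.lookup f) ?D"
  have "bij_betw ?r forms2 (?D \<rightarrow>\<^sub>E UNIV)"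
  proof (rule bij_betw_imageI)
    show "inj_on ?r forms2"
    proof (rule inj_onI)
      fix f g :: "(5, 'a) mpoly"
      assume fg: "f \<in> forms2" "g \<in> forms2" and eq: "?r f = ?r g"
      show "f = g"
      proof (rule poly_mapping_eqI)
        fix m
        show "Poly_Mapping.lookup f m = Poly_Mapping.lookup g m"
        proof (cases "m \<in> ?D")
          case True
          then show ?thesis
            using fun_cong[OF eq, of m] by simp
        next
          case False
          then have "m \<notin> Poly_Mapping.keys f" "m \<notin> Poly_Mapping.keys g"
            using fg deg by (auto simp: forms2_iff_homogeneous homogeneous_def)
          then show ?thesis
            by (simp add: in_keys_iff)
        qed
      qed
    qed
    show "?r ` forms2 = ?D \<rightarrow>\<^sub>E UNIV"
    proof
      show "?D \<rightarrow>\<^sub>E UNIV \<subseteq> ?r ` forms2"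
      proof
        fix h :: "(5 \<Rightarrow>\<^sub>0 nat) \<Rightarrow> 'a" assume h: "h \<in> ?D \<rightarrow>\<^sub>E UNIV"
        let ?f = "\<Sum>m\<in>?D. Poly_Mapping.single m (h m)"
        have "Poly_Mapping.lookup ?f k = h k" if "k \<in> ?D" for k
        proof -
          have "Poly_Mapping.lookup ?f k = (\<Sum>m\<in>?D. if m = k then h m else 0)"
            unfolding lookup_sum by (intro sum.cong) (auto simp: lookup_single)
          also have "\<dots> = h k"
            using that by (simp only: sum.delta finite_imageI finite) simp
          finally show ?thesis .
        qed
        then have r: "?r ?f = h"
          using h by (auto simp: fun_eq_iff restrict_def PiE_def extensional_def)
        have "?f \<in> forms2"
          unfolding forms2_iff_homogeneous
          by (intro homogeneous_sum homogeneous_single) (simp only: deg)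
        then show "h \<in> ?r ` forms2"
          by (rule rev_image_eqI) (rule r[symmetric])
      qed
    qed auto
  qed
  then have "card (forms2 :: (5, 'a) mpoly set) = card (?D \<rightarrow>\<^sub>E (UNIV :: 'a set))"
    by (rule bij_betw_same_card)
  then show ?thesis
    by (simp add: card_PiE card_pairs_5 del: UNIV_Times_UNIV)
qed

lemma codeword_add:
  fixes X :: "('a::field ^ 'n::{finite,linorder}) set set"
  shows "codeword X (f + g) = codeword X f + codeword X g"
  by (auto simp: codeword_def fun_eq_iff normalized_eval_def poly_eval_add add_divide_distrib)

lemma codeword_const_mult:
  fixes X :: "('a::field ^ 'n::{finite,linorder}) set set"
  shows "codeword X (const_poly c * f) = word_scale c (codeword X f)"
  by (auto simp: codeword_def fun_eq_iff normalized_eval_def poly_eval_mult poly_eval_const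
      word_scale_def)

section \<open>The parabolic quadric\<close>

locale parabolic_form =
  fixes g :: "(5, 'a::{field,finite}) mpoly"
  assumes g: "g \<in> forms2" and g_rank: "quadric_rank g = 5"
begin

sublocale nondegenerate_quadratic "poly_eval g"
proof -
  interpret quadratic "poly_eval g"
    by (rule quadratic_poly_eval[OF g])
  show "nondegenerate_quadratic (poly_eval g)"
    by unfold_locales (use full_rank_nonsingular[OF g] g_rank in simp_all)
qed

lemma const_mult_iff:
  assumes "f \<in> forms2"
  shows "f = const_poly c * g \<longleftrightarrow> (\<forall>v. poly_eval f v = c * poly_eval g v)"
proof
  assume "\<forall>v. poly_eval f v = c * poly_eval g v"
  moreover have "const_poly c * g \<in> forms2"
    using g by (simp add: forms2_iff_homogeneous homogeneous_const_mult)
  ultimately show "f = const_poly c * g"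
    using assms by (intro forms2_eqI) (simp_all add: poly_eval_mult poly_eval_const)
qed (simp add: poly_eval_mult poly_eval_const)

section \<open>Point counts for the quadric and its intersections\<close>

lemma card_affine_zeros:
  assumes f: "f \<in> forms2"
  shows "(CARD('a) - 1) * card (zero_set g \<inter> zero_set f) + 1 =
    card {v. poly_eval g v = 0 \<and> poly_eval f v = 0}"
  by (rule card_common_zero_set[OF g f])

lemma card_zero_set: "card (zero_set g) = (CARD('a) + 1) * (CARD('a)^2 + 1)"
proof -
  obtain k where k: "CARD('a) = Suc (Suc k)"
    using two_le_card_field[where 'a = 'a] by (metis add_2_eq_Suc le_Suc_ex)
  have "(CARD('a) - 1) * card (zero_set g) + 1 = CARD('a) ^ 4"
    using card_affine_zeros[OF g] card_zeros by (simp add: zeros_def)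
  also have "\<dots> = (CARD('a) - 1) * ((CARD('a) + 1) * (CARD('a)^2 + 1)) + 1"
    unfolding k by (simp add: algebra_simps eval_nat_numeral)
  finally have "(CARD('a) - 1) * card (zero_set g) = (CARD('a) - 1) * ((CARD('a) + 1) * (CARD('a)^2 + 1))"
    by (rule add_right_imp_eq)
  then show ?thesis
    unfolding mult_cancel1 k by simp
qed

text \<open>Translates the affine bound 2q^3 + q^2 - 2q into the projective one.\<close>

lemma affine_bound:
  "2 * CARD('a) + ((CARD('a) - 1) * (2 * CARD('a)^2 + 3 * CARD('a) + 1) + 1) =
    2 * CARD('a)^3 + CARD('a)^2"
proof -
  obtain k where k: "CARD('a) = Suc (Suc k)"
    using two_le_card_field[where 'a = 'a] by (metis add_2_eq_Suc le_Suc_ex)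
  show ?thesis
    unfolding k by (simp add: algebra_simps eval_nat_numeral)
qed

lemma card_intersection_le:
  assumes f: "f \<in> forms2" and nm: "\<nexists>c. f = const_poly c * g"
  shows "card (zero_set g \<inter> zero_set f) \<le> 2 * CARD('a)^2 + 3 * CARD('a) + 1"
proof -
  have "\<exists>v. poly_eval f v \<noteq> c * poly_eval g v" for c
    using nm const_mult_iff[OF f] by blast
  then have "card {v. poly_eval g v = 0 \<and> poly_eval f v = 0} + 2 * CARD('a)
      \<le> 2 * CARD('a)^3 + CARD('a)^2"
    by (rule card_common_zeros_le[OF quadratic_poly_eval[OF f]])
  then have "(CARD('a) - 1) * card (zero_set g \<inter> zero_set f) \<le>
      (CARD('a) - 1) * (2 * CARD('a)^2 + 3 * CARD('a) + 1)"
    using card_affine_zeros[OF f] affine_bound by linarith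
  then show ?thesis
    using two_le_card_field[where 'a = 'a] unfolding mult_le_cancel1 by linarith
qed

lemma functional_linear_poly:
  assumes l: "functional l"
  shows "poly_eval (\<Sum>i\<in>UNIV. const_poly (l (axis i 1)) * var_poly i) v = l v"
proof -
  have "l (\<Sum>i\<in>I. v $ i *s axis i 1) = (\<Sum>i\<in>I. v $ i * l (axis i 1))" for I
    by (induction I rule: infinite_finite_induct) (simp_all add: functionalD[OF l])
  then have "l v = (\<Sum>i\<in>UNIV. v $ i * l (axis i 1))"
    by (metis basis_expansion)
  then show ?thesis
    by (simp add: poly_eval_sum poly_eval_mult poly_eval_const poly_eval_var mult.commute)
qed

lemma ex_maximal_intersection:
  assumes q: "CARD('a) \<noteq> 2"
  obtains f where "f \<in> forms2" "f \<noteq> 0" "\<nexists>c. f = const_poly c * g"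
    "card (zero_set g \<inter> zero_set f) = 2 * CARD('a)^2 + 3 * CARD('a) + 1"
proof -
  obtain l m where lm: "functional l" "functional m"
    and card: "card {v. poly_eval g v = 0 \<and> l v * m v = 0} + 2 * CARD('a) =
      2 * CARD('a)^3 + CARD('a)^2"
    by (rule ex_secant_pair[OF q], rule that, assumption+)
  define f where "f = (\<Sum>i\<in>UNIV. const_poly (l (axis i 1)) * var_poly i) *
    (\<Sum>i\<in>UNIV. const_poly (m (axis i 1)) * var_poly i)"
  have ev: "poly_eval f v = l v * m v" for v
    by (simp add: f_def poly_eval_mult functional_linear_poly lm)
  have f: "f \<in> forms2"
    using homogeneous_mult[OF homogeneous_linear homogeneous_linear]
    unfolding forms2_iff_homogeneous f_def one_add_one .
  have "(CARD('a) - 1) * card (zero_set g \<inter> zero_set f) =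
      (CARD('a) - 1) * (2 * CARD('a)^2 + 3 * CARD('a) + 1)"
    using card_affine_zeros[OF f] affine_bound card unfolding ev by linarith
  then have N: "card (zero_set g \<inter> zero_set f) = 2 * CARD('a)^2 + 3 * CARD('a) + 1"
    using two_le_card_field[where 'a = 'a] unfolding mult_cancel1 by linarith
  obtain k where k: "CARD('a) = k + 3"
    using two_le_card_field[where 'a = 'a] q le_Suc_ex[of 3 "CARD('a)"] by (auto simp: add.commute)
  \<comment> \<open>Here q \<ge> 3 is needed: at q = 2 both sides are 15. The strict inequality
    shows that \<open>f\<close> misses a point of the quadric and so is no multiple of
    \<open>g\<close>.\<close>
  have lt: "2 * CARD('a)^2 + 3 * CARD('a) + 1 < (CARD('a) + 1) * (CARD('a)^2 + 1)"
    unfolding k by (simp add: algebra_simps eval_nat_numeral)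
  have nm: "\<nexists>c. f = const_poly c * g"
  proof
    assume "\<exists>c. f = const_poly c * g"
    then have "zero_set g \<inter> zero_set f = zero_set g"
      by (auto simp: zero_set_def poly_eval_mult)
    then show False
      using N lt card_zero_set by simp
  qed
  then have "f \<noteq> 0"
    using nm[simplified, rule_format, of 0] by (auto simp: const_poly_def)
  then show thesis
    using that f nm N by blast
qed

section \<open>Parameters of the code\<close>

lemma zero_set_subset: "zero_set g \<subseteq> proj_points"
  by (auto simp: zero_set_def)

lemma codeword_eq_0_iff_multiple:
  assumes f: "f \<in> forms2"
  shows "codeword (zero_set g) f = 0 \<longleftrightarrow> (\<exists>c. f = const_poly c * g)"
proof
  assume 0: "codeword (zero_set g) f = 0"
  have "poly_eval f v = 0" if v: "poly_eval g v = 0" for v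
  proof (cases "v = 0")
    case True
    then show ?thesis
      using poly_eval_scale[OF f, of 0 0] by simp
  next
    case False
    let ?p = "{c *s v |c. c \<noteq> 0}"
    have p: "?p \<in> zero_set g"
      using proj_point_span(1)[OF False] v by (auto simp: zero_set_def poly_eval_scale[OF g])
    have "codeword (zero_set g) f ?p = 0"
      using 0 by simp
    then have "?p \<in> zero_set f"
      using codeword_eq_0_iff[OF f zero_set_subset p] by blast
    then show ?thesis
      using proj_point_span(2)[OF False] unfolding zero_set_def by blast
  qed
  then show "\<exists>c. f = const_poly c * g"
    using multiple_if_vanishes_on_zeros[OF quadratic_poly_eval[OF f]] const_mult_iff[OF f] by blast
next
  assume "\<exists>c. f = const_poly c * g"
  then have "zero_set g \<subseteq> zero_set f"
    by (auto simp: zero_set_def poly_eval_mult)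
  then have "codeword (zero_set g) f p = 0" for p
    using codeword_eq_0_iff[OF f zero_set_subset, of p] by (cases "p \<in> zero_set g") (auto simp: codeword_def)
  then show "codeword (zero_set g) f = 0"
    by (simp add: fun_eq_iff)
qed

lemma finite_forms2: "finite (forms2 :: (5, 'a) mpoly set)"
  using card_forms2[where 'a = 'a] by (intro card_ge_0_finite) simp

text \<open>The kernel of the evaluation map consists of the q multiples of \<open>g\<close>, so
  every fibre is a coset of size q, and q^15 forms give q^14 words.\<close>

lemma card_functional_code2: "card (functional_code2 (zero_set g)) = CARD('a) ^ 14"
proof -
  let ?c = "codeword (zero_set g)"
  have fiber: "card {f \<in> forms2. ?c f = w} = CARD('a)" if w: "w \<in> ?c ` forms2" for w
  proof -
    obtain h where h: "h \<in> forms2" "w = ?c h"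
      using w by blast
    have "{f \<in> forms2. ?c f = w} = range (\<lambda>c. h + const_poly c * g)"
    proof
      show "{f \<in> forms2. ?c f = w} \<subseteq> range (\<lambda>c. h + const_poly c * g)"
      proof clarify
        fix f assume f: "f \<in> forms2" "w = ?c f"
        have m: "f + const_poly (- 1) * h \<in> forms2"
          using f(1) h(1) by (simp add: forms2_iff_homogeneous homogeneous_const_mult homogeneous_add)
        have "?c (f + const_poly (- 1) * h) = 0"
          using f(2) h(2) by (simp add: codeword_add codeword_const_mult word_scale_def fun_eq_iff)
        then obtain c where c: "f + const_poly (- 1) * h = const_poly c * g"
          using codeword_eq_0_iff_multiple[OF m] by blast
        have "poly_eval f v = poly_eval (h + const_poly c * g) v" for v
          using arg_cong[OF c, of "\<lambda>p. poly_eval p v"]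
          by (simp add: poly_eval_add poly_eval_mult poly_eval_const algebra_simps)
        moreover have "h + const_poly c * g \<in> forms2"
          using h(1) g by (simp add: forms2_iff_homogeneous homogeneous_const_mult homogeneous_add)
        ultimately have "f = h + const_poly c * g"
          using f(1) by (intro forms2_eqI)
        then show "f \<in> range (\<lambda>c. h + const_poly c * g)"
          by blast
      qed
      show "range (\<lambda>c. h + const_poly c * g) \<subseteq> {f \<in> forms2. ?c f = w}"
      proof clarify
        fix c
        have m: "const_poly c * g \<in> forms2"
          using g by (simp add: forms2_iff_homogeneous homogeneous_const_mult)
        then have "?c (const_poly c * g) = 0"
          using codeword_eq_0_iff_multiple by blast
        then show "h + const_poly c * g \<in> forms2 \<and> ?c (h + const_poly c * g) = w"
          using m h by (simp add: codeword_add forms2_iff_homogeneous homogeneous_add)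
      qed
    qed
    moreover have "inj (\<lambda>c. h + const_poly c * g)"
    proof (rule injI)
      fix c d assume "h + const_poly c * g = h + const_poly d * g"
      then have eq: "c * poly_eval g v = d * poly_eval g v" for v
        by (metis add_left_imp_eq poly_eval_mult poly_eval_const)
      \<comment> \<open>If \<open>g\<close> vanished everywhere, so would its polar form,
        contradicting nonsingularity at a nonzero zero.\<close>
      obtain v where "poly_eval g v \<noteq> 0"
        using nonsingular ex_zero by (auto simp: polar_def) (metis diff_0_right)
      then show "c = d"
        using eq[of v] by simp
    qed
    ultimately show ?thesis
      by (simp add: card_image)
  qed
  have "card (forms2 :: (5, 'a) mpoly set) = (\<Sum>w\<in>?c ` forms2. card {f. f \<in> forms2 \<and> ?c f = w})"
    using sum.image_gen[OF finite_forms2, of "\<lambda>_. 1 :: nat" ?c] by simp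
  also have "\<dots> = CARD('a) * card (?c ` forms2)"
    using fiber by simp
  finally have "CARD('a) * card (functional_code2 (zero_set g)) = CARD('a) * CARD('a) ^ 14"
    unfolding card_forms2 functional_code2_def by (simp flip: power_Suc)
  then show ?thesis
    by simp
qed

lemma code_dim: "code_dim (functional_code2 (zero_set g)) = 14"
proof -
  interpret W: vector_space "word_scale :: 'a \<Rightarrow> ((('a ^ 5) set) \<Rightarrow> 'a) \<Rightarrow> (('a ^ 5) set) \<Rightarrow> 'a"
    by (rule vector_space_word_scale)
  let ?C = "functional_code2 (zero_set g)"
  have "W.subspace ?C"
  proof (rule W.subspaceI)
    have "(0 :: (5, 'a) mpoly) \<in> forms2" "codeword (zero_set g) 0 = 0"
      by (auto simp: forms2_def codeword_def normalized_eval_def poly_eval_0 fun_eq_iff)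
    then show "0 \<in> ?C"
      unfolding functional_code2_def by (metis rev_image_eqI)
  next
    fix w u assume "w \<in> ?C" "u \<in> ?C"
    then obtain f h where "f \<in> forms2" "h \<in> forms2" "w = codeword (zero_set g) f" "u = codeword (zero_set g) h"
      by (auto simp: functional_code2_def)
    then have "f + h \<in> forms2" "w + u = codeword (zero_set g) (f + h)"
      by (simp_all add: codeword_add forms2_iff_homogeneous homogeneous_add)
    then show "w + u \<in> ?C"
      unfolding functional_code2_def by blast
  next
    fix c w assume "w \<in> ?C"
    then obtain f where "f \<in> forms2" "w = codeword (zero_set g) f"
      by (auto simp: functional_code2_def)
    then have "const_poly c * f \<in> forms2" "word_scale c w = codeword (zero_set g) (const_poly c * f)"
      by (simp_all add: codeword_const_mult forms2_iff_homogeneous homogeneous_const_mult)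
    then show "word_scale c w \<in> ?C"
      unfolding functional_code2_def by blast
  qed
  then have "CARD('a) ^ 14 = CARD('a) ^ W.dim ?C"
    using W.card_subspace[of ?C] finite_forms2 card_functional_code2
    by (simp add: functional_code2_def)
  then show ?thesis
    using two_le_card_field[where 'a = 'a] unfolding code_dim_def by (simp add: power_inject_exp)
qed

text \<open>The lightest nonzero words come from the largest intersections. Integers are used so
  that the final difference is not truncated.\<close>

lemma min_distance:
  assumes q: "CARD('a) \<noteq> 2"
  shows "int (min_distance (functional_code2 (zero_set g))) =
    int CARD('a) ^ 3 - int CARD('a) ^ 2 - 2 * int CARD('a)"
proof -
  let ?C = "functional_code2 (zero_set g)" and ?N = "2 * CARD('a)^2 + 3 * CARD('a) + 1"
  let ?d = "card (zero_set g) - ?N"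
  obtain f where f: "f \<in> forms2" "\<nexists>c. f = const_poly c * g"
    and N: "card (zero_set g \<inter> zero_set f) = ?N"
    by (rule ex_maximal_intersection[OF q], rule that, assumption+)
  have "min_distance ?C = ?d"
    unfolding min_distance_def
  proof (rule Min_eqI)
    show "finite (weight ` (?C - {0}))"
      using finite_forms2 by (simp add: functional_code2_def)
    show "?d \<le> y" if y: "y \<in> weight ` (?C - {0})" for y
    proof -
      obtain h where h: "h \<in> forms2" "codeword (zero_set g) h \<noteq> 0" "y = weight (codeword (zero_set g) h)"
        using y by (auto simp: functional_code2_def)
      have "card (zero_set g \<inter> zero_set h) \<le> ?N"
        using h codeword_eq_0_iff_multiple by (intro card_intersection_le) auto
      then show ?thesis
        unfolding h(3) weight_codeword[OF h(1) zero_set_subset] by (rule diff_le_mono2)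
    qed
    have "codeword (zero_set g) f \<in> ?C - {0}"
      using f codeword_eq_0_iff_multiple by (simp add: functional_code2_def)
    moreover have "weight (codeword (zero_set g) f) = ?d"
      using weight_codeword[OF f(1) zero_set_subset] N by simp
    ultimately show "?d \<in> weight ` (?C - {0})"
      by (metis rev_image_eqI)
  qed
  moreover have "?N \<le> card (zero_set g)"
    unfolding N[symmetric] by (intro card_mono) auto
  ultimately have "int (min_distance ?C) = int ((CARD('a) + 1) * (CARD('a)^2 + 1)) - int ?N"
    unfolding card_zero_set by (simp only: of_nat_diff)
  then show ?thesis
    by (simp add: algebra_simps power3_eq_cube power2_eq_square)
qed

end

text \<open>For q = 2 the bound 15 is the number of all points of the quadric. By
  \<open>codeword_eq_0_iff_multiple\<close>, a form that is no multiple of the equation misses some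
  point, so the bound is not attained and the minimum distance cannot be q^3 - q^2 - 2q = 0. Hence
  the restriction to \<open>q \<noteq> 2\<close> in these two claims.\<close>

theorem theorem4p1:
  fixes f\<^sub>X :: "(5, 'a::{field,finite}) mpoly" and q :: nat
  assumes q: "q = CARD('a)"
    and f\<^sub>X: "f\<^sub>X \<in> forms2" "f\<^sub>X \<noteq> 0" "quadric_rank f\<^sub>X = 5"
  shows
    "(\<forall>f :: (5, 'a) mpoly. f \<in> forms2 \<and> f \<noteq> 0 \<and> (\<nexists>c. f = const_poly c * f\<^sub>X) \<longrightarrow>
        card (zero_set f\<^sub>X \<inter> zero_set f) \<le> 2 * q^2 + 3 * q + 1) \<and>
     (q \<noteq> 2 \<longrightarrow>
        (\<exists>f :: (5, 'a) mpoly. f \<in> forms2 \<and> f \<noteq> 0 \<and> (\<nexists>c. f = const_poly c * f\<^sub>X) \<and>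
           card (zero_set f\<^sub>X \<inter> zero_set f) = 2 * q^2 + 3 * q + 1)) \<and>
     card (zero_set f\<^sub>X) = (q + 1) * (q^2 + 1) \<and>
     code_dim (functional_code2 (zero_set f\<^sub>X)) = 14 \<and>
     (q \<noteq> 2 \<longrightarrow>
        int (min_distance (functional_code2 (zero_set f\<^sub>X))) = int q ^ 3 - int q ^ 2 - 2 * int q)"
proof -
  interpret parabolic_form f\<^sub>X
    using f\<^sub>X by unfold_locales
  show ?thesis
    unfolding q
  proof (intro conjI impI allI)
    show "\<exists>f :: (5, 'a) mpoly. f \<in> forms2 \<and> f \<noteq> 0 \<and> (\<nexists>c. f = const_poly c * f\<^sub>X) \<and>
        card (zero_set f\<^sub>X \<inter> zero_set f) = 2 * CARD('a)^2 + 3 * CARD('a) + 1"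
      if "CARD('a) \<noteq> 2"
      using ex_maximal_intersection[OF that] by metis
  qed (use card_intersection_le card_zero_set code_dim min_distance in auto)
qed

end
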